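(* Let $(\mathcal{P},\circ,[\cdot,\cdot])$ be a simple finite-dimensional non-trivial transposed Poisson algebra over an algebraically closed field $\mathbb{F}$ of characteristic $p>3$. Then the Lie algebra $(\mathcal{P},[\cdot,\cdot])$ is isomorphic to the Zassenhaus algebra $\mathcal{W}(1;n)$ for some $n\in\mathbb{N}$.
   Context: A transposed Poisson algebra over a field $\mathbb{F}$ of characteristic $\neq 2$ is a vector space $\mathcal{P}$ with an associative commutative multiplication $\circ$ (not assumed unital) and a Lie bracket $[\cdot,\cdot]$ satisfying $2x\circ[y,z]=[x\circ y,z]+[y,x\circ z]$ for all $x,y,z\in\mathcal{P}$. An ideal is a subspace that is an ideal for both multiplications simultaneously; $\mathcal{P}$ is simple if it has exactly two ideals, zero and $\mathcal{P}$. It is trivial if one of the two multiplications is zero, and non-trivial otherwise. For $n\geq 1$, the divided powers algebra $\mathcal{O}(1;n)$ is the commutative associative unital algebra with basis $x^{(i)}$, $0\le i<p^n$, and multiplication $x^{(i)}x^{(j)}=\binom{i+j}{j}x^{(i+j)}$ with $x^{(k)}=0$ for $k\geq p^n$. Let $\partial$ be its derivation with $\partial(x^{(i)})=x^{(i-1)}$ ($\partial(x^{(0)})=0$). The Zassenhaus algebra is $\mathcal{W}(1;n)=\mathcal{O}(1;n)\partial$ with Lie bracket $[f\partial,g\partial]=(f\,\partial(g)-\partial(f)\,g)\partial$. *)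

theory Defs
  imports
    "HOL-Library.Function_Algebras"
    "HOL-Computational_Algebra.Computational_Algebra"
begin

section \<open>Transposed Poisson algebras\<close>

locale bilinear_operation = vector_space scale
  for scale :: "'f::field \<Rightarrow> 'v::ab_group_add \<Rightarrow> 'v" +
  fixes op :: "'v \<Rightarrow> 'v \<Rightarrow> 'v"
  assumes linear_right: "Vector_Spaces.linear scale scale (\<lambda>y. op x y)"
    and linear_left: "Vector_Spaces.linear scale scale (\<lambda>x. op x y)"

locale comm_assoc_algebra = bilinear_operation scale mult
  for scale :: "'f::field \<Rightarrow> 'v::ab_group_add \<Rightarrow> 'v"
    and mult :: "'v \<Rightarrow> 'v \<Rightarrow> 'v" +
  assumes mult_assoc: "mult (mult x y) z = mult x (mult y z)"
    and mult_commute: "mult x y = mult y x"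

locale lie_algebra = bilinear_operation scale bracket
  for scale :: "'f::field \<Rightarrow> 'v::ab_group_add \<Rightarrow> 'v"
    and bracket :: "'v \<Rightarrow> 'v \<Rightarrow> 'v" +
  assumes bracket_self: "bracket x x = 0"
    and jacobi: "bracket x (bracket y z) + bracket y (bracket z x) + bracket z (bracket x y) = 0"

locale transposed_poisson_algebra =
  comm_assoc_algebra scale mult + lie_algebra scale bracket
  for scale :: "'f::field \<Rightarrow> 'v::ab_group_add \<Rightarrow> 'v"
    and mult :: "'v \<Rightarrow> 'v \<Rightarrow> 'v"
    and bracket :: "'v \<Rightarrow> 'v \<Rightarrow> 'v" +
  assumes char_neq_2: "CHAR('f) \<noteq> 2"
    and transposed_leibniz:
      "scale 2 (mult x (bracket y z)) = bracket (mult x y) z + bracket y (mult x z)"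
begin

definition ideal :: "'v set \<Rightarrow> bool" where
  "ideal I \<longleftrightarrow> subspace I \<and>
     (\<forall>x. \<forall>y\<in>I. mult x y \<in> I \<and> mult y x \<in> I \<and> bracket x y \<in> I \<and> bracket y x \<in> I)"

definition simple :: bool where
  "simple \<longleftrightarrow> {I. ideal I} = {{0}, UNIV} \<and> {0} \<noteq> (UNIV :: 'v set)"

definition trivial :: bool where
  "trivial \<longleftrightarrow> (\<forall>x y. mult x y = 0) \<or> (\<forall>x y. bracket x y = 0)"

end


section \<open>Divided powers and the Zassenhaus algebra\<close>

text \<open>
  An element of the divided powers algebra is encoded by its coefficient sequence:
  \<open>f\<close> stands for the sum of \<open>f i * x^(i)\<close> over \<open>i < p ^ n\<close>, where \<open>p\<close> is the
  characteristic of the field.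
\<close>

definition fun_scale :: "'f::field \<Rightarrow> (nat \<Rightarrow> 'f) \<Rightarrow> (nat \<Rightarrow> 'f)" where
  "fun_scale c f = (\<lambda>i. c * f i)"

definition dp_carrier :: "nat \<Rightarrow> (nat \<Rightarrow> 'f::field) set" where
  "dp_carrier n = {f. \<forall>i \<ge> CHAR('f) ^ n. f i = 0}"

definition dp_basis :: "nat \<Rightarrow> nat \<Rightarrow> (nat \<Rightarrow> 'f::field)" where
  "dp_basis n i = (\<lambda>k. if k = i \<and> i < CHAR('f) ^ n then 1 else 0)"

text \<open>
  The bilinear extension of the multiplication rule for the basis; see \<open>dp_mult_basis\<close>.
\<close>
definition dp_mult :: "nat \<Rightarrow> (nat \<Rightarrow> 'f::field) \<Rightarrow> (nat \<Rightarrow> 'f) \<Rightarrow> (nat \<Rightarrow> 'f)" where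
  "dp_mult n f g =
     (\<lambda>k. if k < CHAR('f) ^ n then \<Sum>j\<le>k. of_nat (k choose j) * f (k - j) * g j else 0)"

definition dp_deriv :: "(nat \<Rightarrow> 'f::field) \<Rightarrow> (nat \<Rightarrow> 'f)" where
  "dp_deriv f = (\<lambda>k. f (Suc k))"

text \<open>
  The Zassenhaus algebra has carrier \<open>dp_carrier n\<close>, the vector field \<open>f \<partial>\<close> being
  encoded by \<open>f\<close>.
\<close>
definition zassenhaus_bracket ::
    "nat \<Rightarrow> (nat \<Rightarrow> 'f::field) \<Rightarrow> (nat \<Rightarrow> 'f) \<Rightarrow> (nat \<Rightarrow> 'f)" where
  "zassenhaus_bracket n f g = dp_mult n f (dp_deriv g) - dp_mult n (dp_deriv f) g"

text \<open>
  The Lie algebra on the left is a whole type; the one on the right is a subspace \<open>L\<close>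
  of the ambient vector space, with bracket restricted to \<open>L\<close>.
\<close>
definition lie_isomorphic ::
    "('f::field \<Rightarrow> 'v::ab_group_add \<Rightarrow> 'v) \<Rightarrow> ('v \<Rightarrow> 'v \<Rightarrow> 'v) \<Rightarrow>
     ('f \<Rightarrow> 'w::ab_group_add \<Rightarrow> 'w) \<Rightarrow> 'w set \<Rightarrow> ('w \<Rightarrow> 'w \<Rightarrow> 'w) \<Rightarrow> bool" where
  "lie_isomorphic scale1 bracket1 scale2 L bracket2 \<longleftrightarrow>
     (\<exists>\<phi>. Vector_Spaces.linear scale1 scale2 \<phi> \<and> bij_betw \<phi> UNIV L \<and>
          (\<forall>x y. \<phi> (bracket1 x y) = bracket2 (\<phi> x) (\<phi> y)))"

lemma vector_space_fun_scale: "vector_space fun_scale"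
  by unfold_locales (auto simp: fun_scale_def fun_eq_iff algebra_simps)

lemma subspace_dp_carrier: "module.subspace fun_scale (dp_carrier n)"
proof -
  interpret vector_space fun_scale by (rule vector_space_fun_scale)
  show ?thesis by (auto simp: subspace_def dp_carrier_def fun_scale_def)
qed

lemma dp_basis_in_carrier: "dp_basis n i \<in> dp_carrier n"
  by (auto simp: dp_basis_def dp_carrier_def)

lemma dp_carrier_expansion:
  fixes f :: "nat \<Rightarrow> 'f::field"
  assumes "f \<in> dp_carrier n"
  shows "f k = (\<Sum>i<CHAR('f) ^ n. f i * dp_basis n i k)"
proof -
  have "(\<Sum>i<CHAR('f) ^ n. f i * dp_basis n i k) =
        (\<Sum>i<CHAR('f) ^ n. if i = k then f i else 0)"
    by (intro sum.cong) (auto simp: dp_basis_def)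
  then show ?thesis
    using assms by (auto simp: dp_carrier_def)
qed

lemma dp_mult_basis:
  assumes "i < CHAR('f) ^ n" "j < CHAR('f) ^ n"
  shows "dp_mult n (dp_basis n i) (dp_basis n j) =
         fun_scale (of_nat ((i + j) choose j)) (dp_basis n (i + j) :: nat \<Rightarrow> 'f::field)"
proof
  fix k
  have "(\<Sum>l\<le>k. of_nat (k choose l) * dp_basis n i (k - l) * dp_basis n j l) =
        (\<Sum>l\<le>k. if l = j then (if k - l = i then of_nat (k choose l) else 0) else (0::'f))"
    using assms by (intro sum.cong) (auto simp: dp_basis_def)
  also have "\<dots> = (if k = i + j then of_nat (k choose j) else 0)"
    by (auto simp: sum.delta)
  finally show "dp_mult n (dp_basis n i) (dp_basis n j) k =
      fun_scale (of_nat ((i + j) choose j)) (dp_basis n (i + j) :: nat \<Rightarrow> 'f) k"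
    by (auto simp: dp_mult_def fun_scale_def dp_basis_def)
qed

lemma dp_deriv_basis_0: "dp_deriv (dp_basis n 0) = 0"
  by (auto simp: dp_deriv_def dp_basis_def fun_eq_iff)

lemma dp_deriv_basis_Suc:
  fixes n i :: nat
  assumes "Suc i < CHAR('f) ^ n"
  shows "dp_deriv (dp_basis n (Suc i)) = (dp_basis n i :: nat \<Rightarrow> 'f::field)"
  using assms by (auto simp: dp_deriv_def dp_basis_def fun_eq_iff)

lemma zassenhaus_bracket_in_carrier: "zassenhaus_bracket n f g \<in> dp_carrier n"
  by (auto simp: zassenhaus_bracket_def dp_mult_def dp_carrier_def)

end

theory Submission
  imports Defs
begin

text \<open>
  Call a linear map \<open>\<phi>\<close> with \<open>2 \<phi>[y,z] = [\<phi> y,z] + [y,\<phi> z]\<close> a half-derivation. The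
  multiplication operators of a transposed Poisson algebra are commuting half-derivations, and for
  every half-derivation \<open>\<phi>\<close> the product \<open>(z, y) \<mapsto> [ad z, \<phi>] y\<close> is commutative with
  multiplication operators that are again half-derivations. In characteristic other than 2 and 3,
  all operators obtained from the multiplications by repeatedly commuting with \<open>ad z\<close> still
  commute with each other.

  In the simple case the generalized null space of each of these operators is an ideal, so each is
  nilpotent or bijective. They are not all nilpotent, because their common kernel would be a nonzero
  ideal on which the multiplication vanishes. Dividing a product with a bijective multiplication by
  \<open>u\<close> by that operator gives an associative commutative product with unit \<open>u\<close>, all of whose
  multiplications are half-derivations; hence \<open>D = ad u\<close> is a derivation of it,
  \<open>[y,z] = y D(z) - z D(y)\<close>, and the product has no proper nonzero \<open>D\<close>-stable ideals.

  Among the derivations \<open>w D\<close> with \<open>w\<close> invertible, one with generalized null space of maximal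
  dimension is nilpotent: if \<open>D t = c t\<close> with \<open>c \<noteq> 0\<close>, then \<open>t\<close> is invertible and
  \<open>t\<^sup>-\<^sup>1 D\<close> has a strictly larger generalized null space. For nilpotent \<open>D\<close>, the Taylor expansion
  \<open>x \<mapsto> \<Sum>k. \<epsilon>(D\<^sup>k x) x^(k)\<close>, with \<open>\<epsilon>\<close> the residue map of the local algebra, is an isomorphism
  of differential algebras onto \<open>O(1;n)\<close>.
\<close>

section \<open>Half-derivations of Lie algebras\<close>

context vector_space
begin

lemma linear_self_iff:
  "Vector_Spaces.linear scale scale f \<longleftrightarrow>
     (\<forall>x y. f (x + y) = f x + f y) \<and> (\<forall>c x. f (scale c x) = scale c (f x))"
  by (simp add: Vector_Spaces.linear_iff vector_space_axioms)

lemma double_cancel: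
  fixes x y :: 'b
  assumes "CHAR('a) \<noteq> 2" "x + x = y + y"
  shows "x = y"
proof -
  have "(2::'a) \<noteq> 0"
    using assms(1) of_nat_eq_0_iff_char_dvd[where 'a='a, of 2] CHAR_not_1'[where 'a='a]
    by (auto dest: dvd_imp_le simp: le_Suc_eq numeral_2_eq_2)
  moreover have "scale 2 x = scale 2 y"
    using assms(2) by (metis one_add_one scale_left_distrib scale_one)
  ultimately show ?thesis by simp
qed

lemma triple_cancel:
  fixes x y :: 'b
  assumes "CHAR('a) \<noteq> 3" "x + x + x = y + y + y"
  shows "x = y"
proof -
  have "(3::'a) \<noteq> 0"
  proof
    assume "(3::'a) = 0"
    then have "CHAR('a) dvd 3"
      using of_nat_eq_0_iff_char_dvd[where 'a='a, of 3] by simp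
    moreover have "prime (3::nat)" by simp
    ultimately show False
      using assms(1) CHAR_not_1'[where 'a='a] by (metis One_nat_def prime_nat_iff)
  qed
  moreover have "scale 3 z = z + z + z" for z
    by (metis add.assoc is_num_normalize(1) numeral_Bit1 numeral_One one_add_one
        scale_left_distrib scale_one)
  then have "scale 3 x = scale 3 y"
    using assms(2) by simp
  ultimately show ?thesis by simp
qed

end

context bilinear_operation
begin

lemma op_add_right: "op x (y + z) = op x y + op x z"
  and op_scale_right: "op x (scale c y) = scale c (op x y)"
  and op_add_left: "op (x + y) z = op x z + op y z"
  and op_scale_left: "op (scale c x) y = scale c (op x y)"
  using linear_right linear_left unfolding linear_self_iff by auto

lemma op_zero_right: "op x 0 = 0"
  and op_zero_left: "op 0 x = 0"
  using op_scale_right[of x 0 0] op_scale_left[of 0 0 x] by simp_all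

lemma op_minus_right: "op x (- y) = - op x y"
  and op_minus_left: "op (- x) y = - op x y"
  using op_scale_right[of x "-1" y] op_scale_left[of "-1" x y] by simp_all

lemma op_diff_right: "op x (y - z) = op x y - op x z"
  and op_diff_left: "op (x - y) z = op x z - op y z"
  using op_add_right[of x y "-z"] op_add_left[of x "-y" z] by (simp_all add: op_minus_right op_minus_left)

lemmas op_bilinear = op_add_right op_add_left op_scale_right op_scale_left
  op_zero_right op_zero_left op_minus_right op_minus_left op_diff_right op_diff_left

end

context lie_algebra
begin

lemma bracket_swap: "bracket x y = - bracket y x"
proof -
  have "bracket (x + y) (x + y) = bracket x y + bracket y x"
    unfolding op_add_left op_add_right by (simp add: bracket_self)
  then show ?thesis by (simp add: eq_neg_iff_add_eq_0 bracket_self)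
qed

lemma bracket_zero_right: "bracket x 0 = 0"
  by (rule op_zero_right)

lemma bracket_derivation:
  "bracket z (bracket x y) = bracket (bracket z x) y + bracket x (bracket z y)"
proof -
  have "bracket (bracket z x) y = - bracket y (bracket z x)" by (rule bracket_swap)
  moreover have "bracket x (bracket z y) = - bracket x (bracket y z)"
    by (subst (2) bracket_swap) (simp add: op_bilinear)
  moreover have "bracket z (bracket x y) =
      (bracket x (bracket y z) + bracket y (bracket z x) + bracket z (bracket x y))
       - bracket y (bracket z x) - bracket x (bracket y z)"
    by simp
  ultimately show ?thesis
    by (simp add: jacobi)
qed

text \<open>The factor 2 appears as a repeated summand, so that the law is applied by additive
  rewriting; \<open>double_cancel\<close> takes over division by 2.\<close>

definition half_derivation :: "('v \<Rightarrow> 'v) \<Rightarrow> bool" where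
  "half_derivation \<phi> \<longleftrightarrow> Vector_Spaces.linear scale scale \<phi> \<and>
     (\<forall>y z. \<phi> (bracket y z) + \<phi> (bracket y z) = bracket (\<phi> y) z + bracket y (\<phi> z))"

definition ad_commutator :: "'v \<Rightarrow> ('v \<Rightarrow> 'v) \<Rightarrow> 'v \<Rightarrow> 'v" where
  "ad_commutator z \<phi> = (\<lambda>y. bracket z (\<phi> y) - \<phi> (bracket z y))"

text \<open>The last conjunct is what multiplication operators supply by associativity. Unlike mere
  commutation, the whole condition passes to commutators with ad z.\<close>

definition compatible :: "('v \<Rightarrow> 'v) \<Rightarrow> ('v \<Rightarrow> 'v) \<Rightarrow> bool" where
  "compatible \<phi> \<psi> \<longleftrightarrow> half_derivation \<phi> \<and> half_derivation \<psi> \<and>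
     (\<forall>x. \<phi> (\<psi> x) = \<psi> (\<phi> x)) \<and> half_derivation (\<lambda>x. \<phi> (\<psi> x))"

lemma half_derivationD:
  assumes "half_derivation \<phi>"
  shows "bracket (\<phi> y) z = \<phi> (bracket y z) + \<phi> (bracket y z) - bracket y (\<phi> z)"
    and "\<phi> (x + y) = \<phi> x + \<phi> y" and "\<phi> (scale c x) = scale c (\<phi> x)"
    and "\<phi> (x - y) = \<phi> x - \<phi> y" and "\<phi> 0 = 0" and "\<phi> (- x) = - \<phi> x"
proof -
  interpret f: Vector_Spaces.linear scale scale \<phi>
    using assms by (simp add: half_derivation_def)
  show "bracket (\<phi> y) z = \<phi> (bracket y z) + \<phi> (bracket y z) - bracket y (\<phi> z)"
    using assms by (simp add: half_derivation_def)
  show "\<phi> (x + y) = \<phi> x + \<phi> y" "\<phi> (scale c x) = scale c (\<phi> x)"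
    "\<phi> (x - y) = \<phi> x - \<phi> y" "\<phi> 0 = 0" "\<phi> (- x) = - \<phi> x"
    by (rule f.add f.scale f.diff f.zero f.neg)+
qed

lemma ad_commutator_alt:
  assumes "half_derivation \<phi>"
  shows "ad_commutator z \<phi> y = \<phi> (bracket z y) - bracket (\<phi> z) y"
  by (simp add: ad_commutator_def half_derivationD[OF assms])

text \<open>By the half-derivation law, \<open>[z, \<phi> y] - \<phi> [z, y]\<close> equals
  \<open>\<phi> [z, y] - [\<phi> z, y]\<close>, and antisymmetry turns this into the first
  expression with \<open>z\<close> and \<open>y\<close> exchanged.\<close>

lemma ad_commutator_commute:
  assumes "half_derivation \<phi>"
  shows "ad_commutator z \<phi> y = ad_commutator y \<phi> z"
proof -
  have "bracket z (\<phi> y) = - (\<phi> (bracket y z) + \<phi> (bracket y z) - bracket y (\<phi> z))"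
    using bracket_swap[of z "\<phi> y"] half_derivationD(1)[OF assms, of y z] by simp
  then show ?thesis
    by (simp add: ad_commutator_def half_derivationD[OF assms] bracket_swap[of z y])
qed

text \<open>Apply the derivation ad z to the half-derivation law of \<open>\<phi>\<close> and
  subtract the laws at \<open>[z, x], y\<close> and at \<open>x, [z, y]\<close>.\<close>

lemma half_derivation_ad_commutator:
  assumes "half_derivation \<phi>"
  shows "half_derivation (ad_commutator z \<phi>)"
proof -
  note D = half_derivationD[OF assms]
  let ?c = "ad_commutator z \<phi>"
  have "?c (bracket x y) + ?c (bracket x y) = bracket (?c x) y + bracket x (?c y)" for x y
  proof -
    have "\<phi> (bracket x y) + \<phi> (bracket x y) = bracket (\<phi> x) y + bracket x (\<phi> y)"
      by (simp add: D)
    then have "bracket z (\<phi> (bracket x y)) + bracket z (\<phi> (bracket x y)) =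
        bracket (bracket z (\<phi> x)) y + bracket (\<phi> x) (bracket z y) +
        (bracket (bracket z x) (\<phi> y) + bracket x (bracket z (\<phi> y)))"
      by (metis bracket_derivation op_add_right)
    then show ?thesis
      unfolding ad_commutator_def bracket_derivation[of z x y]
      by (simp add: D op_bilinear algebra_simps)
  qed
  moreover have "Vector_Spaces.linear scale scale ?c"
    by (simp add: linear_self_iff ad_commutator_def D op_bilinear algebra_simps)
  ultimately show ?thesis by (simp add: half_derivation_def)
qed

lemma half_derivation_comp_linear:
  assumes "half_derivation \<phi>" "half_derivation \<psi>"
  shows "Vector_Spaces.linear scale scale (\<lambda>x. \<phi> (\<psi> x))"
  by (simp add: linear_self_iff half_derivationD[OF assms(1)] half_derivationD[OF assms(2)])

text \<open>Up to the factor 2, the commutator of \<open>\<psi>\<close> with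
  \<open>ad_commutator z \<phi>\<close> measures how far the composite of \<open>\<phi>\<close> and
  \<open>\<psi>\<close> is from being a half-derivation.\<close>

lemma commutator_ad_commutator:
  assumes \<phi>: "half_derivation \<phi>" and \<psi>: "half_derivation \<psi>" and comm: "\<And>x. \<phi> (\<psi> x) = \<psi> (\<phi> x)"
  shows "(\<psi> (ad_commutator z \<phi> y) - ad_commutator z \<phi> (\<psi> y)) +
      (\<psi> (ad_commutator z \<phi> y) - ad_commutator z \<phi> (\<psi> y)) =
    \<phi> (\<psi> (bracket z y)) + \<phi> (\<psi> (bracket z y)) - bracket (\<phi> (\<psi> z)) y - bracket z (\<phi> (\<psi> y))"
proof -
  note D = half_derivationD[OF \<phi>] half_derivationD[OF \<psi>]
  have a: "\<psi> (bracket (\<phi> z) y) + \<psi> (bracket (\<phi> z) y) = bracket (\<phi> (\<psi> z)) y + bracket (\<phi> z) (\<psi> y)"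
    using \<psi> by (simp add: half_derivation_def comm)
  have b: "\<phi> (bracket z (\<psi> y)) + \<phi> (bracket z (\<psi> y)) = bracket (\<phi> z) (\<psi> y) + bracket z (\<phi> (\<psi> y))"
    using \<phi> by (simp add: half_derivation_def)
  \<comment> \<open>The left side is arranged so that \<open>a\<close> and \<open>b\<close> apply;
    the mixed brackets \<open>[\<phi> z, \<psi> y]\<close> then cancel.\<close>
  have "?thesis \<longleftrightarrow> \<psi> (\<phi> (bracket z y)) + \<psi> (\<phi> (bracket z y))
     - (\<psi> (bracket (\<phi> z) y) + \<psi> (bracket (\<phi> z) y))
     - (\<phi> (bracket z (\<psi> y)) + \<phi> (bracket z (\<psi> y)))
     + bracket (\<phi> z) (\<psi> y) + bracket (\<phi> z) (\<psi> y) =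
    \<phi> (\<psi> (bracket z y)) + \<phi> (\<psi> (bracket z y)) - bracket (\<phi> (\<psi> z)) y - bracket z (\<phi> (\<psi> y))"
    unfolding ad_commutator_alt[OF \<phi>] D(4) D(10) by (simp add: algebra_simps)
  then show ?thesis
    unfolding a b by (simp add: comm algebra_simps)
qed

lemma half_derivation_comp_iff:
  assumes "CHAR('f) \<noteq> 2"
    and \<phi>: "half_derivation \<phi>" and \<psi>: "half_derivation \<psi>" and comm: "\<And>x. \<phi> (\<psi> x) = \<psi> (\<phi> x)"
  shows "half_derivation (\<lambda>x. \<phi> (\<psi> x)) \<longleftrightarrow>
    (\<forall>z y. \<psi> (ad_commutator z \<phi> y) = ad_commutator z \<phi> (\<psi> y))"
proof -
  have "(\<psi> (ad_commutator z \<phi> y) = ad_commutator z \<phi> (\<psi> y)) \<longleftrightarrow>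
    \<phi> (\<psi> (bracket z y)) + \<phi> (\<psi> (bracket z y)) = bracket (\<phi> (\<psi> z)) y + bracket z (\<phi> (\<psi> y))" for z y
  proof -
    let ?d = "\<psi> (ad_commutator z \<phi> y) - ad_commutator z \<phi> (\<psi> y)"
    have "?d = 0 \<longleftrightarrow> ?d + ?d = 0"
      using double_cancel[OF assms(1), of ?d 0] by auto
    then show ?thesis
      unfolding commutator_ad_commutator[OF \<phi> \<psi> comm] by (simp add: algebra_simps)
  qed
  then show ?thesis
    by (simp add: half_derivation_def half_derivation_comp_linear[OF \<phi> \<psi>])
qed

text \<open>The doubled commutator \<open>?K\<close> is antisymmetric in its two arguments because
  the bracket is; combined with commutativity of the product of \<open>\<psi>\<close>, this makes
  \<open>\<chi>\<close> a half-derivation of that product.\<close>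

lemma half_derivation_of_ad_commutator:
  assumes char2: "CHAR('f) \<noteq> 2"
    and \<chi>: "half_derivation \<chi>" and \<psi>: "half_derivation \<psi>" and comm: "\<And>x. \<chi> (\<psi> x) = \<psi> (\<chi> x)"
  shows "\<chi> (ad_commutator w \<psi> y) + \<chi> (ad_commutator w \<psi> y) =
    ad_commutator w \<psi> (\<chi> y) + ad_commutator y \<psi> (\<chi> w)"
proof -
  let ?K = "\<lambda>w y. \<chi> (ad_commutator w \<psi> y) - ad_commutator w \<psi> (\<chi> y)"
  have K: "?K w y + ?K w y = \<psi> (\<chi> (bracket w y)) + \<psi> (\<chi> (bracket w y)) - bracket (\<psi> (\<chi> w)) y - bracket w (\<psi> (\<chi> y))" for w y
    by (rule commutator_ad_commutator[OF \<psi> \<chi>]) (simp add: comm)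
  have "(?K w y + ?K y w) + (?K w y + ?K y w) = (?K w y + ?K w y) + (?K y w + ?K y w)"
    by (simp add: algebra_simps)
  also have "\<dots> = 0"
    unfolding K
    using bracket_swap[of y w] bracket_swap[of "\<psi> (\<chi> y)" w] bracket_swap[of "\<psi> (\<chi> w)" y]
    by (simp add: half_derivationD(6)[OF \<chi>] half_derivationD(6)[OF \<psi>])
  finally have "?K w y + ?K y w = 0"
    using double_cancel[OF char2, of "?K w y + ?K y w" 0] by simp
  then show ?thesis
    using ad_commutator_commute[OF \<psi>, of w y] by (simp add: algebra_simps)
qed

lemma bracket_eq_ad_commutator: "\<phi> (bracket z y) = bracket z (\<phi> y) - ad_commutator z \<phi> y"
  by (simp add: ad_commutator_def)

text \<open>Apply \<open>\<phi>\<close> to the law of \<open>\<psi>\<close> and subtract the law of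
  the composite; the mixed terms remain. For \<open>\<phi> = \<psi>\<close> this is the rule by
  which a bijective operator is later divided out of the bracket.\<close>

lemma compatible_bracket:
  assumes "compatible \<phi> \<psi>"
  shows "bracket (\<phi> x) (\<psi> y) + bracket (\<psi> x) (\<phi> y) =
    \<phi> (\<psi> (bracket x y)) + \<phi> (\<psi> (bracket x y))"
proof -
  have \<phi>: "half_derivation \<phi>" and \<psi>: "half_derivation \<psi>"
    and \<phi>\<psi>: "half_derivation (\<lambda>x. \<phi> (\<psi> x))" and comm: "\<And>x. \<phi> (\<psi> x) = \<psi> (\<phi> x)"
    using assms by (auto simp: compatible_def)
  note E = half_derivation_def
  have "\<phi> (\<psi> (bracket x y) + \<psi> (bracket x y)) + \<phi> (\<psi> (bracket x y) + \<psi> (bracket x y)) =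
      (\<phi> (bracket (\<psi> x) y) + \<phi> (bracket (\<psi> x) y)) + (\<phi> (bracket x (\<psi> y)) + \<phi> (bracket x (\<psi> y)))"
    using \<psi> by (simp add: E half_derivationD(2)[OF \<phi>])
  also have "\<dots> = bracket (\<phi> (\<psi> x)) y + bracket (\<psi> x) (\<phi> y) + (bracket (\<phi> x) (\<psi> y) + bracket x (\<phi> (\<psi> y)))"
    using \<phi> by (simp only: E)
  also have "\<dots> = bracket (\<phi> x) (\<psi> y) + bracket (\<psi> x) (\<phi> y) +
      (\<phi> (\<psi> (bracket x y)) + \<phi> (\<psi> (bracket x y)))"
    using \<phi>\<psi> by (simp add: E algebra_simps)
  finally show ?thesis by (simp add: half_derivationD(2)[OF \<phi>])
qed

lemma compatible_sym: "compatible \<phi> \<psi> \<Longrightarrow> compatible \<psi> \<phi>"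
  by (auto simp: compatible_def)

lemma compatible_ad_commutator_commute:
  assumes "CHAR('f) \<noteq> 2" "compatible \<phi> \<psi>"
  shows "\<psi> (ad_commutator z \<phi> y) = ad_commutator z \<phi> (\<psi> y)"
  using half_derivation_comp_iff[OF assms(1)] assms(2) by (auto simp: compatible_def)

text \<open>
  With \<open>\<bullet>\<close> and \<open>*\<close> the products belonging to \<open>\<phi>\<close> and \<open>\<psi>\<close>, the trilinear maps
  \<open>T z w y = z \<bullet> (w * y)\<close> and \<open>S z w y = z * (w \<bullet> y)\<close> satisfy
  \<open>2 T z w y = S w z y + S y z w\<close> and the same with \<open>T\<close> and \<open>S\<close> exchanged; eliminating \<open>S\<close>
  makes \<open>3 T\<close> totally symmetric, and then \<open>S = T\<close>.
\<close>
lemma compatible_ad_commutators_commute: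
  assumes char2: "CHAR('f) \<noteq> 2" and char3: "CHAR('f) \<noteq> 3" and comp: "compatible \<phi> \<psi>"
  shows "ad_commutator w \<psi> (ad_commutator z \<phi> y) = ad_commutator z \<phi> (ad_commutator w \<psi> y)"
proof -
  have \<phi>: "half_derivation \<phi>" and \<psi>: "half_derivation \<psi>"
    using comp by (auto simp: compatible_def)
  define T S where "T = (\<lambda>z w y. ad_commutator z \<phi> (ad_commutator w \<psi> y))"
    and "S = (\<lambda>z w y. ad_commutator z \<psi> (ad_commutator w \<phi> y))"
  have T_sym: "T z w y = T z y w" for z w y
    by (simp add: T_def ad_commutator_commute[OF \<psi>, of w])
  have T: "T z w y + T z w y = S w z y + S y z w" for z w y
    unfolding T_def S_def
    by (rule half_derivation_of_ad_commutator[OF char2 half_derivation_ad_commutator[OF \<phi>] \<psi>])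
      (simp add: compatible_ad_commutator_commute[OF char2 comp])
  have S: "S z w y + S z w y = T w z y + T y z w" for z w y
    unfolding T_def S_def
    by (rule half_derivation_of_ad_commutator[OF char2 half_derivation_ad_commutator[OF \<psi>] \<phi>])
      (simp add: compatible_ad_commutator_commute[OF char2 compatible_sym[OF comp]])
  have TT: "T z w y + T z w y = T w z y + T y z w" for z w y
  proof (rule double_cancel[OF char2])
    have "(T z w y + T z w y) + (T z w y + T z w y) = (S w z y + S w z y) + (S y z w + S y z w)"
      unfolding T by (simp add: algebra_simps)
    also have "\<dots> = (T z w y + T y w z) + (T z y w + T w y z)"
      unfolding S by simp
    finally have "T z w y + T z w y = T w z y + T y z w"
      unfolding T_sym[of z y w] T_sym[of y w z] T_sym[of w y z] by (simp add: algebra_simps)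
    then show "T z w y + T z w y + (T z w y + T z w y) =
        T w z y + T y z w + (T w z y + T y z w)" by simp
  qed
  have T_eq: "T z w y = T w z y" for z w y
  proof (rule triple_cancel[OF char3])
    have "T z w y + T z w y + T z w y = T z w y + T w z y + T y z w" for z w y
      using TT[of z w y] by (simp add: algebra_simps)
    from this[of z w y] this[of w z y]
    show "T z w y + T z w y + T z w y = T w z y + T w z y + T w z y"
      unfolding T_sym[of y w z] by (simp add: algebra_simps)
  qed
  have "S w z y = T z w y"
  proof (rule double_cancel[OF char2])
    have "T y w z = T z w y"
      using T_eq[of y w z] T_sym[of w y z] T_eq[of w z y] by simp
    then show "S w z y + S w z y = T z w y + T z w y" by (simp add: S)
  qed
  then show ?thesis by (simp add: S_def T_def)
qed

text \<open>By \<open>half_derivation_comp_iff\<close>, the composite is a half-derivation as soon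
  as \<open>ad_commutator z \<phi>\<close> commutes with every
  \<open>ad_commutator w \<psi>\<close>.\<close>

lemma compatible_ad_commutator:
  assumes "CHAR('f) \<noteq> 2" "CHAR('f) \<noteq> 3" "compatible \<phi> \<psi>"
  shows "compatible (ad_commutator z \<phi>) \<psi>"
proof -
  have \<phi>: "half_derivation \<phi>" and \<psi>: "half_derivation \<psi>"
    using assms(3) by (auto simp: compatible_def)
  note \<phi>z = half_derivation_ad_commutator[OF \<phi>, of z]
  have comm: "\<psi> (ad_commutator z \<phi> x) = ad_commutator z \<phi> (\<psi> x)" for x
    by (rule compatible_ad_commutator_commute[OF assms(1,3)])
  have "half_derivation (\<lambda>x. \<psi> (ad_commutator z \<phi> x))"
    unfolding half_derivation_comp_iff[OF assms(1) \<psi> \<phi>z comm]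
    by (simp add: compatible_ad_commutators_commute[OF assms])
  then show ?thesis
    using \<phi>z \<psi> by (simp add: compatible_def comm)
qed

end

section \<open>Binomial coefficients in positive characteristic\<close>

text \<open>This is the induction step that turns the Leibniz rule into the binomial formula for
  higher derivatives.\<close>

lemma sum_pascal:
  fixes a b :: "nat \<Rightarrow> 'f::comm_semiring_1"
  shows "(\<Sum>j\<le>Suc k. of_nat (Suc k choose j) * a (Suc k - j) * b j) =
    (\<Sum>j\<le>k. of_nat (k choose j) * a (Suc (k - j)) * b j) +
    (\<Sum>j\<le>k. of_nat (k choose j) * a (k - j) * b (Suc j))"
proof -
  have "(\<Sum>j\<le>k. of_nat (k choose j) * a (Suc (k - j)) * b j) =
      (\<Sum>j\<le>Suc k. of_nat (k choose j) * a (Suc k - j) * b j)"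
    by (auto simp: Suc_diff_le binomial_eq_0 intro!: sum.cong)
  also have "\<dots> = a (Suc k) * b 0 + (\<Sum>j\<le>k. of_nat (k choose Suc j) * a (k - j) * b (Suc j))"
    by (subst sum.atMost_Suc_shift) simp
  finally show ?thesis
    by (subst sum.atMost_Suc_shift) (simp add: sum.distrib[symmetric] algebra_simps del: sum.atMost_Suc)
qed

text \<open>If the characteristic p divides \<open>N\<close>, injectivity of the Frobenius map on
  polynomials takes a p-th root of the identity. Otherwise, differentiating and evaluating at -1
  leaves \<open>0 ^ (N - 1) = (-1) ^ (N - 1)\<close>, which forces \<open>N = 1\<close>.\<close>

lemma add_one_pow_imp_CHAR_power:
  fixes N :: nat
  assumes "N > 0" "CHAR('f::field) > 0"
    and "([:1, 1:] :: 'f poly) ^ N = 1 + [:0, 1:] ^ N"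
  shows "\<exists>n. N = CHAR('f) ^ n"
  using assms(1,3)
proof (induction N rule: less_induct)
  case (less N)
  have p: "prime CHAR('f)"
    using assms(2) by (rule prime_CHAR_semidom)
  show ?case
  proof (cases "CHAR('f) dvd N")
    case True
    then obtain M where M: "N = CHAR('f) * M" by blast
    have M0: "0 < M" "M < N"
      using less.prems(1) prime_gt_1_nat[OF p] by (auto simp: M)
    have fd: "(a + b) ^ CHAR('f) = a ^ CHAR('f) + b ^ CHAR('f)" for a b :: "'f poly"
      using p by (simp add: freshmans_dream)
    have "([:1, 1 :: 'f:] ^ M) ^ CHAR('f) = (1 + [:0, 1:] ^ M) ^ CHAR('f)"
      using less.prems(2) fd[of 1 "[:0, 1:] ^ M"]
      by (simp add: M mult.commute flip: power_mult)
    moreover have "a = b" if "a ^ CHAR('f) = b ^ CHAR('f)" for a b :: "'f poly"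
    proof -
      have "(a - b) ^ CHAR('f) + b ^ CHAR('f) = b ^ CHAR('f)"
        unfolding fd[symmetric] using that by simp
      then show ?thesis by simp
    qed
    ultimately have "([:1, 1:] :: 'f poly) ^ M = 1 + [:0, 1:] ^ M" by blast
    from less.IH[OF M0(2,1) this] obtain n where "M = CHAR('f) ^ n" by blast
    then have "N = CHAR('f) ^ Suc n" by (simp add: M)
    then show ?thesis by blast
  next
    case False
    then have nz: "of_nat N \<noteq> (0::'f)"
      by (simp add: of_nat_eq_0_iff_char_dvd)
    obtain m where m: "N = Suc m"
      using less.prems(1) by (cases N) auto
    have "pderiv ([:1, 1:] ^ N) = pderiv (1 + [:0, 1::'f:] ^ N)"
      by (simp only: less.prems)
    then have "poly (pderiv ([:1, 1:] ^ N)) (-1) = poly (pderiv (1 + [:0, 1:] ^ N)) (-1::'f)"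
      by simp
    then have "of_nat N * 0 ^ m = of_nat N * (-1::'f) ^ m"
      unfolding m pderiv_power_Suc pderiv_add by (simp add: pderiv_pCons poly_power)
    then have "(0::'f) ^ m = (-1) ^ m"
      using nz by simp
    then have "m = 0"
      by (cases m) auto
    then have "N = CHAR('f) ^ 0" by (simp add: m)
    then show ?thesis by blast
  qed
qed

lemma choose_zero_imp_CHAR_power:
  assumes "N > 0" "CHAR('f::field) > 0"
    and "\<And>j. 0 < j \<Longrightarrow> j < N \<Longrightarrow> of_nat (N choose j) = (0::'f)"
  shows "\<exists>n. N = CHAR('f) ^ n"
proof (rule add_one_pow_imp_CHAR_power[OF assms(1,2)])
  have "([:1, 1:] :: 'f poly) = [:0, 1:] + 1" by (simp add: one_pCons)
  then have "([:1, 1:] :: 'f poly) ^ N = (\<Sum>k\<le>N. of_nat (N choose k) * [:0, 1:] ^ k)"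
    by (simp only: binomial_ring power_one mult_1_right)
  also have "\<dots> = (\<Sum>k\<in>{0, N}. of_nat (N choose k) * [:0, 1:] ^ k)"
    by (rule sum.mono_neutral_right) (auto simp: of_nat_poly assms(3))
  also have "\<dots> = 1 + [:0, 1:] ^ N"
    using assms(1) by simp
  finally show "([:1, 1:] :: 'f poly) ^ N = 1 + [:0, 1:] ^ N" .
qed

section \<open>Generalized null spaces and eigenvalues\<close>

definition gen_kernel :: "('b::zero \<Rightarrow> 'b) \<Rightarrow> 'b set" where
  "gen_kernel f = {x. \<exists>k. (f ^^ k) x = 0}"

context vector_space
begin

lemma linear_selfD:
  assumes "Vector_Spaces.linear scale scale f"
  shows "f (x + y) = f x + f y" "f (scale c x) = scale c (f x)" "f 0 = 0" "f (x - y) = f x - f y"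
    "f (- x) = - f x" "f (sum g A) = (\<Sum>a\<in>A. f (g a))"
proof -
  interpret f: Vector_Spaces.linear scale scale f by fact
  show "f (x + y) = f x + f y" "f (scale c x) = scale c (f x)" "f 0 = 0" "f (x - y) = f x - f y"
    "f (- x) = - f x" "f (sum g A) = (\<Sum>a\<in>A. f (g a))"
    by (rule f.add f.scale f.zero f.diff f.neg f.sum)+
qed

lemma linear_funpow:
  assumes "Vector_Spaces.linear scale scale f"
  shows "Vector_Spaces.linear scale scale (f ^^ k)"
  by (induction k) (auto simp: linear_self_iff linear_selfD[OF assms])

lemma funpow_zero_mono:
  assumes "Vector_Spaces.linear scale scale f" "(f ^^ k) x = 0" "k \<le> m"
  shows "(f ^^ m) x = 0"
proof -
  have "(f ^^ m) x = (f ^^ (m - k)) ((f ^^ k) x)"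
    using assms(3) by (metis comp_apply funpow_add le_add_diff_inverse2)
  then show ?thesis
    by (simp add: assms(2) linear_selfD[OF linear_funpow[OF assms(1)]])
qed

lemma gen_kernelI: "(f ^^ k) x = 0 \<Longrightarrow> x \<in> gen_kernel f"
  by (auto simp: gen_kernel_def)

lemma subspace_gen_kernel:
  assumes f: "Vector_Spaces.linear scale scale f"
  shows "subspace (gen_kernel f)"
proof (rule subspaceI)
  show "0 \<in> gen_kernel f"
    by (rule gen_kernelI[where k=0]) simp
next
  fix x y assume "x \<in> gen_kernel f" "y \<in> gen_kernel f"
  then obtain k l where "(f ^^ k) x = 0" "(f ^^ l) y = 0"
    by (auto simp: gen_kernel_def)
  then have "(f ^^ (max k l)) (x + y) = 0"
    using funpow_zero_mono[OF f, of k x "max k l"] funpow_zero_mono[OF f, of l y "max k l"]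
    by (simp add: linear_selfD[OF linear_funpow[OF f]])
  then show "x + y \<in> gen_kernel f" by (rule gen_kernelI)
next
  fix c x assume "x \<in> gen_kernel f"
  then show "scale c x \<in> gen_kernel f"
    by (auto simp: gen_kernel_def linear_selfD[OF linear_funpow[OF f]])
qed

lemma gen_kernel_apply_iff: "f x \<in> gen_kernel f \<longleftrightarrow> x \<in> gen_kernel f"
  if "Vector_Spaces.linear scale scale f"
proof
  assume "f x \<in> gen_kernel f"
  then obtain k where "(f ^^ k) (f x) = 0" by (auto simp: gen_kernel_def)
  then have "(f ^^ Suc k) x = 0" by (simp add: funpow_swap1)
  then show "x \<in> gen_kernel f" by (rule gen_kernelI)
next
  assume "x \<in> gen_kernel f"
  then obtain k where "(f ^^ k) x = 0" by (auto simp: gen_kernel_def)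
  then have "(f ^^ k) (f x) = 0"
    using linear_selfD(3)[OF that] by (metis funpow_swap1)
  then show "f x \<in> gen_kernel f" by (rule gen_kernelI)
qed

text \<open>The iterate just before the first vanishing one does this.\<close>

lemma gen_kernel_obtain_kernel:
  assumes "x \<in> gen_kernel f" "x \<noteq> 0"
  obtains k where "(f ^^ k) x \<noteq> 0" "f ((f ^^ k) x) = 0"
proof -
  define m where "m = (LEAST k. (f ^^ k) x = 0)"
  have m: "(f ^^ m) x = 0"
    using assms(1) unfolding m_def gen_kernel_def by (auto intro: LeastI)
  with assms(2) obtain k where k: "m = Suc k" by (cases m) auto
  have "(f ^^ k) x \<noteq> 0"
    using not_less_Least[of k "\<lambda>k. (f ^^ k) x = 0"] by (auto simp: m_def[symmetric] k)
  then show ?thesis using m that by (simp add: k)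
qed

lemma gen_kernel_trivial_imp_inj:
  assumes f: "Vector_Spaces.linear scale scale f" and "gen_kernel f = {0}"
  shows "inj f"
proof (rule injI)
  fix x y assume "f x = f y"
  then have "(f ^^ 1) (x - y) = 0" by (simp add: linear_selfD[OF f])
  then have "x - y \<in> gen_kernel f" by (rule gen_kernelI)
  then show "x = y" using assms(2) by simp
qed

end

section \<open>Eigenvalues over an algebraically closed field\<close>

locale fin_dim_alg_closed = finite_dimensional_vector_space scale Basis
  for scale :: "'f::alg_closed_field \<Rightarrow> 'v::ab_group_add \<Rightarrow> 'v" and Basis
begin

definition poly_op :: "('v \<Rightarrow> 'v) \<Rightarrow> 'f poly \<Rightarrow> 'v \<Rightarrow> 'v" where
  "poly_op f q x = (\<Sum>i\<le>degree q. scale (coeff q i) ((f ^^ i) x))"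

lemma poly_op_bound:
  assumes "degree q \<le> n"
  shows "poly_op f q x = (\<Sum>i\<le>n. scale (coeff q i) ((f ^^ i) x))"
  unfolding poly_op_def
  by (rule sum.mono_neutral_left) (use assms in \<open>auto simp: coeff_eq_0\<close>)

lemma poly_op_diff: "poly_op f (q - r) x = poly_op f q x - poly_op f r x"
proof -
  let ?n = "max (degree q) (degree r)"
  have "degree (q - r) \<le> ?n" by (rule degree_diff_le) auto
  then show ?thesis
    by (simp add: poly_op_bound[of _ ?n] scale_left_diff_distrib sum_subtractf)
qed

lemma poly_op_smult: "poly_op f (smult c q) x = scale c (poly_op f q x)"
  by (simp add: poly_op_bound[of _ "degree q"] scale_sum_right)

lemma poly_op_monom: "poly_op f (monom c k) x = scale c ((f ^^ k) x)"
proof -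
  have "poly_op f (monom c k) x = (\<Sum>i\<le>k. if i = k then scale c ((f ^^ i) x) else 0)"
    unfolding poly_op_bound[OF degree_monom_le] by (intro sum.cong) auto
  then show ?thesis by simp
qed

lemma poly_op_pCons_0: "poly_op f (pCons 0 q) x = poly_op f q (f x)"
proof -
  have "poly_op f (pCons 0 q) x = (\<Sum>i\<le>Suc (degree q). scale (coeff (pCons 0 q) i) ((f ^^ i) x))"
    by (rule poly_op_bound) (simp add: degree_pCons_le)
  then show ?thesis
    by (simp add: sum.atMost_Suc_shift poly_op_def funpow_swap1 del: sum.atMost_Suc)
qed

lemma poly_op_apply:
  assumes "Vector_Spaces.linear scale scale f"
  shows "poly_op f q (f x) = f (poly_op f q x)"
  unfolding poly_op_def linear_selfD[OF assms] by (simp add: funpow_swap1)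

lemma poly_op_linear_factor:
  assumes "Vector_Spaces.linear scale scale f"
  shows "poly_op f ([:- c, 1:] * q) x = f (poly_op f q x) - scale c (poly_op f q x)"
proof -
  have "[:- c, 1:] * q = pCons 0 q - smult c q" by simp
  then show ?thesis
    by (simp only: poly_op_diff poly_op_smult poly_op_pCons_0 poly_op_apply[OF assms])
qed

text \<open>One more iterate than the dimension gives a linear dependence. Coinciding iterates are
  treated separately, since the set of iterates would not record their repetition.\<close>

lemma exists_annihilating_poly: "\<exists>q. q \<noteq> 0 \<and> poly_op f q x = 0"
proof (cases "inj_on (\<lambda>i. (f ^^ i) x) {..dimension}")
  case False
  then obtain i j where ij: "i < j" "(f ^^ i) x = (f ^^ j) x"
    unfolding inj_on_def by (metis nat_neq_iff)
  let ?q = "monom 1 j - monom 1 i :: 'f poly"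
  have "coeff ?q j = 1" using ij by simp
  then have "?q \<noteq> 0" by (metis coeff_0 zero_neq_one)
  moreover have "poly_op f ?q x = 0"
    using ij by (simp add: poly_op_diff poly_op_monom)
  ultimately show ?thesis by blast
next
  case True
  let ?S = "(\<lambda>i. (f ^^ i) x) ` {..dimension}"
  have "card ?S = Suc dimension" by (simp add: card_image[OF True])
  then have "dependent ?S"
    using independent_bound_general[of ?S] dim_subset_UNIV[of ?S] by fastforce
  then obtain u where u: "\<exists>v\<in>?S. u v \<noteq> 0" "(\<Sum>v\<in>?S. scale (u v) v) = 0"
    by (auto simp: dependent_finite)
  define q where "q = (\<Sum>i\<le>dimension. monom (u ((f ^^ i) x)) i)"
  have coeff: "coeff q i = (if i \<le> dimension then u ((f ^^ i) x) else 0)" for i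
    by (simp add: q_def coeff_sum)
  then have "degree q \<le> dimension" by (intro degree_le) simp
  then have "poly_op f q x = 0"
    using u(2) by (simp add: poly_op_bound coeff sum.reindex[OF True])
  moreover have "q \<noteq> 0"
    using u(1) coeff by (metis (no_types, lifting) atMost_iff coeff_0 imageE)
  ultimately show ?thesis by blast
qed

text \<open>Split off a root \<open>c\<close> of an annihilating polynomial, leaving
  \<open>r\<close>. For \<open>c = 0\<close>, \<open>r\<close> annihilates \<open>f x\<close>, which
  is still outside the generalized null space; otherwise \<open>r(f) x\<close> is an eigenvector or
  \<open>r\<close> already annihilates \<open>x\<close>.\<close>

lemma exists_nonzero_eigenvalue:
  fixes x :: 'v
  assumes f: "Vector_Spaces.linear scale scale f" and "x \<notin> gen_kernel f"
  shows "\<exists>c v. c \<noteq> 0 \<and> v \<noteq> 0 \<and> f v = scale c v"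
proof -
  obtain q where "q \<noteq> 0" "poly_op f q x = 0"
    using exists_annihilating_poly by blast
  then show ?thesis
    using assms(2)
  proof (induction "degree q" arbitrary: q x rule: less_induct)
    case less
    have x: "x \<noteq> 0"
      using less.prems(3) subspace_0[OF subspace_gen_kernel[OF f]] by auto
    have "degree q > 0"
    proof (rule ccontr)
      assume "\<not> degree q > 0"
      then obtain a where "q = [:a:]" by (metis degree_eq_zeroE neq0_conv)
      then show False using less.prems x by (simp add: poly_op_def)
    qed
    then obtain c where "poly q c = 0"
      using alg_closed_imp_poly_has_root by blast
    then obtain r where r: "q = [:- c, 1:] * r"
      by (auto simp: poly_eq_0_iff_dvd)
    then have r0: "r \<noteq> 0" using less.prems by auto
    then have deg: "degree r < degree q"
      unfolding r by (subst degree_mult_eq) auto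
    have eig: "f (poly_op f r x) = scale c (poly_op f r x)"
      using less.prems(2) by (simp add: r poly_op_linear_factor[OF f] del: mult_pCons_left)
    show ?case
    proof (cases "c = 0")
      case True
      then have "poly_op f r (f x) = 0"
        using eig by (simp add: poly_op_apply[OF f])
      with less.hyps[OF deg r0 this] less.prems(3) show ?thesis
        by (simp add: gen_kernel_apply_iff[OF f])
    next
      case False
      then show ?thesis
        using less.hyps[OF deg r0, of x] less.prems(3) eig by blast
    qed
  qed
qed

lemma exists_eigenvalue:
  fixes x :: 'v
  assumes f: "Vector_Spaces.linear scale scale f" and "x \<noteq> 0"
  shows "\<exists>c v. v \<noteq> 0 \<and> f v = scale c v"
proof (cases "x \<in> gen_kernel f")
  case True
  then obtain k where "(f ^^ k) x \<noteq> 0" "f ((f ^^ k) x) = 0"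
    using gen_kernel_obtain_kernel assms(2) by blast
  then show ?thesis by (intro exI[of _ 0] exI[of _ "(f ^^ k) x"]) simp
next
  case False
  then show ?thesis using exists_nonzero_eigenvalue[OF f] by blast
qed

end

section \<open>Differentially simple algebras\<close>

locale simple_differential_algebra =
  comm_assoc_algebra scale mult + fin_dim_alg_closed scale Basis
  for scale :: "'f::alg_closed_field \<Rightarrow> 'v::ab_group_add \<Rightarrow> 'v"
    and mult :: "'v \<Rightarrow> 'v \<Rightarrow> 'v" (infixl \<open>\<odot>\<close> 70)
    and Basis :: "'v set" +
  fixes \<ee> :: 'v and D :: "'v \<Rightarrow> 'v"
  assumes unit_mult: "\<ee> \<odot> x = x"
    and unit_nonzero: "\<ee> \<noteq> 0"
    and linear_D: "Vector_Spaces.linear scale scale D"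
    and D_mult: "D (x \<odot> y) = D x \<odot> y + x \<odot> D y"
    and differentially_simple:
      "subspace J \<Longrightarrow> (\<And>a x. x \<in> J \<Longrightarrow> a \<odot> x \<in> J) \<Longrightarrow> (\<And>x. x \<in> J \<Longrightarrow> D x \<in> J) \<Longrightarrow>
        J = {0} \<or> J = UNIV"
begin

section \<open>Invertible elements and nilpotent multiplications\<close>

definition invertible :: "'v \<Rightarrow> bool" where
  "invertible x \<longleftrightarrow> (\<exists>y. x \<odot> y = \<ee>)"

lemma mult_unit: "x \<odot> \<ee> = x"
  using unit_mult mult_commute by metis

lemma mult_left_commute: "x \<odot> (y \<odot> z) = y \<odot> (x \<odot> z)"
  by (metis mult_assoc mult_commute)

lemmas mult_ac = mult_assoc mult_commute mult_left_commute

lemmas D_linear = linear_selfD[OF linear_D]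

lemma D_unit: "D \<ee> = 0"
  using D_mult[of \<ee> \<ee>] by (simp add: unit_mult mult_unit)

lemma invertible_cancel: "invertible x \<Longrightarrow> x \<odot> y = 0 \<Longrightarrow> y = 0"
  unfolding invertible_def by (metis mult_assoc mult_commute op_zero_right unit_mult)

lemma invertible_mult: "invertible (x \<odot> y) \<longleftrightarrow> invertible x \<and> invertible y"
proof
  assume "invertible (x \<odot> y)"
  then obtain z where "(x \<odot> y) \<odot> z = \<ee>" by (auto simp: invertible_def)
  then have "x \<odot> (y \<odot> z) = \<ee>" "y \<odot> (x \<odot> z) = \<ee>" by (simp_all add: mult_ac)
  then show "invertible x \<and> invertible y" by (auto simp: invertible_def)
next
  assume "invertible x \<and> invertible y"
  then obtain a b where "x \<odot> a = \<ee>" "y \<odot> b = \<ee>" by (auto simp: invertible_def)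
  then have "(x \<odot> y) \<odot> (a \<odot> b) = \<ee>"
    by (metis mult_assoc mult_commute mult_unit)
  then show "invertible (x \<odot> y)" by (auto simp: invertible_def)
qed

lemma linear_mult: "Vector_Spaces.linear scale scale ((\<odot>) x)"
  using linear_right .

text \<open>The principal ideal of \<open>x\<close> is stable under \<open>D\<close>, because
  \<open>D (a \<odot> x) = (D a + a \<odot> c) \<odot> x\<close>; being nonzero, it contains the
  unit.\<close>

lemma invertible_if_D_multiple:
  assumes "x \<noteq> 0" "D x = c \<odot> x"
  shows "invertible x"
proof -
  let ?J = "range (\<lambda>a. a \<odot> x)"
  have "subspace ?J"
  proof (rule subspaceI)
    show "0 \<in> ?J" by (metis op_zero_left rangeI)
  qed (auto simp flip: op_add_left op_scale_left)
  moreover have "a \<odot> y \<in> ?J" if "y \<in> ?J" for a y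
    using that by (auto simp flip: mult_assoc)
  moreover have "D y \<in> ?J" if "y \<in> ?J" for y
  proof -
    from that obtain a where a: "y = a \<odot> x" by blast
    have "D y = (D a + a \<odot> c) \<odot> x"
      by (simp add: a D_mult assms(2) op_add_left mult_assoc)
    then show ?thesis by blast
  qed
  ultimately have "?J = {0} \<or> ?J = UNIV" by (rule differentially_simple)
  moreover have "x \<in> ?J" by (metis unit_mult rangeI)
  ultimately have "\<ee> \<in> ?J" using assms(1) by auto
  then show ?thesis by (metis invertible_def mult_commute rangeE)
qed

lemma funpow_mult_commute: "((\<odot>) x ^^ k) (a \<odot> y) = a \<odot> ((\<odot>) x ^^ k) y"
  by (induction k) (simp_all add: mult_left_commute)

text \<open>The null space is an ideal since multiplications commute. Stability under
  \<open>D\<close> follows by induction on the exponent from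
  \<open>x \<odot> D y = D (x \<odot> y) - D x \<odot> y\<close>.\<close>

lemma gen_kernel_mult_cases: "gen_kernel ((\<odot>) x) = {0} \<or> gen_kernel ((\<odot>) x) = UNIV"
proof (rule differentially_simple)
  let ?G = "gen_kernel ((\<odot>) x)"
  show sub: "subspace ?G" by (rule subspace_gen_kernel[OF linear_mult])
  show ideal: "a \<odot> y \<in> ?G" if "y \<in> ?G" for a y
  proof -
    from that obtain k where "((\<odot>) x ^^ k) y = 0" by (auto simp: gen_kernel_def)
    then have "((\<odot>) x ^^ k) (a \<odot> y) = 0" by (simp add: funpow_mult_commute op_zero_right)
    then show ?thesis by (rule gen_kernelI)
  qed
  show "D y \<in> ?G" if "y \<in> ?G" for y
  proof -
    from that obtain k where "((\<odot>) x ^^ k) y = 0" by (auto simp: gen_kernel_def)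
    then show ?thesis
    proof (induction k arbitrary: y)
      case 0
      then show ?case using subspace_0[OF sub] by (simp add: D_linear)
    next
      case (Suc k)
      then have "((\<odot>) x ^^ k) (x \<odot> y) = 0" by (simp add: funpow_swap1)
      then have "D (x \<odot> y) \<in> ?G" "x \<odot> y \<in> ?G"
        by (auto intro: Suc.IH gen_kernelI)
      moreover have "y \<in> ?G" using \<open>x \<odot> y \<in> ?G\<close> gen_kernel_apply_iff[OF linear_mult] by blast
      then have "D x \<odot> y \<in> ?G" by (rule ideal)
      ultimately have "D (x \<odot> y) - D x \<odot> y \<in> ?G" by (intro subspace_diff[OF sub])
      then have "x \<odot> D y \<in> ?G" by (simp add: D_mult)
      then show ?case using gen_kernel_apply_iff[OF linear_mult] by blast
    qed
  qed
qed

lemma not_invertible_iff: "\<not> invertible x \<longleftrightarrow> gen_kernel ((\<odot>) x) = UNIV"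
proof
  assume "\<not> invertible x"
  show "gen_kernel ((\<odot>) x) = UNIV"
  proof (rule ccontr)
    assume "gen_kernel ((\<odot>) x) \<noteq> UNIV"
    then have "inj ((\<odot>) x)"
      using gen_kernel_mult_cases gen_kernel_trivial_imp_inj[OF linear_mult] by blast
    then have "surj ((\<odot>) x)" by (rule linear_inj_imp_surj[OF linear_mult])
    then show False using \<open>\<not> invertible x\<close> by (metis invertible_def surjD)
  qed
next
  assume G: "gen_kernel ((\<odot>) x) = UNIV"
  then have "\<ee> \<in> gen_kernel ((\<odot>) x)" by simp
  then obtain k where "((\<odot>) x ^^ k) \<ee> \<noteq> 0" "x \<odot> ((\<odot>) x ^^ k) \<ee> = 0"
    using gen_kernel_obtain_kernel unit_nonzero by blast
  then show "\<not> invertible x" using invertible_cancel by blast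
qed

lemma not_invertible_zero: "\<not> invertible 0"
  using unit_nonzero by (auto simp: invertible_def op_zero_left)

lemma not_invertible_scale: "\<not> invertible x \<Longrightarrow> \<not> invertible (scale c x)"
  by (metis invertible_def op_scale_left op_scale_right)

text \<open>This makes the algebra local. If \<open>(x + y) \<odot> s\<close> were the unit, a
  nonzero \<open>a\<close> killed by the nilpotent \<open>y \<odot> s\<close> would be fixed by
  \<open>x \<odot> s\<close>, which is nilpotent as well.\<close>

lemma not_invertible_add:
  assumes "\<not> invertible x" "\<not> invertible y"
  shows "\<not> invertible (x + y)"
proof
  assume "invertible (x + y)"
  then obtain s where s: "(x + y) \<odot> s = \<ee>" by (auto simp: invertible_def)
  have "\<not> invertible (y \<odot> s)" using assms(2) by (simp add: invertible_mult)
  then have "\<ee> \<in> gen_kernel ((\<odot>) (y \<odot> s))" by (simp add: not_invertible_iff)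
  then obtain k where k: "((\<odot>) (y \<odot> s) ^^ k) \<ee> \<noteq> 0" "(y \<odot> s) \<odot> ((\<odot>) (y \<odot> s) ^^ k) \<ee> = 0"
    using gen_kernel_obtain_kernel unit_nonzero by blast
  define a where "a = ((\<odot>) (y \<odot> s) ^^ k) \<ee>"
  have "\<ee> = x \<odot> s + y \<odot> s" using s by (simp add: op_add_left)
  then have "a = (x \<odot> s) \<odot> a + (y \<odot> s) \<odot> a"
    by (metis op_add_left unit_mult)
  then have fixed: "(x \<odot> s) \<odot> a = a" using k(2) by (simp add: a_def)
  have "((\<odot>) (x \<odot> s) ^^ m) a = a" for m
    by (induction m) (simp_all add: fixed)
  then have "a \<notin> gen_kernel ((\<odot>) (x \<odot> s))"
    using k(1) by (simp add: gen_kernel_def a_def[symmetric])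
  moreover have "\<not> invertible (x \<odot> s)" using assms(1) by (simp add: invertible_mult)
  ultimately show False by (simp add: not_invertible_iff)
qed

lemma not_invertible_diff: "\<not> invertible x \<Longrightarrow> \<not> invertible y \<Longrightarrow> \<not> invertible (x - y)"
  using not_invertible_add[of x "scale (-1) y"] not_invertible_scale[of y "-1"] by simp

lemma invertible_scale_unit: "c \<noteq> 0 \<Longrightarrow> invertible (scale c \<ee>)"
  unfolding invertible_def
  by (rule exI[of _ "scale (1 / c) \<ee>"]) (simp add: op_scale_left op_scale_right unit_mult)

section \<open>The residue map and the Taylor expansion\<close>

definition augmentation :: "'v \<Rightarrow> 'f" where
  "augmentation x = (THE c. \<not> invertible (x - scale c \<ee>))"

lemma augmentation_eqI:
  assumes "\<not> invertible (x - scale c \<ee>)"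
  shows "augmentation x = c"
  unfolding augmentation_def
proof (rule the_equality)
  show "\<not> invertible (x - scale c \<ee>)" by fact
next
  fix d assume "\<not> invertible (x - scale d \<ee>)"
  then have "\<not> invertible ((x - scale d \<ee>) - (x - scale c \<ee>))"
    using assms by (rule not_invertible_diff)
  moreover have "(x - scale d \<ee>) - (x - scale c \<ee>) = scale (c - d) \<ee>"
    by (simp add: scale_left_diff_distrib)
  ultimately show "d = c" using invertible_scale_unit[of "c - d"] by auto
qed

text \<open>Any eigenvalue of multiplication by \<open>x\<close> is the residue, so existence comes
  from algebraic closedness; uniqueness is \<open>augmentation_eqI\<close>.\<close>

lemma not_invertible_augmentation: "\<not> invertible (x - scale (augmentation x) \<ee>)"
proof -
  obtain c v where v: "v \<noteq> 0" "x \<odot> v = scale c v"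
    using exists_eigenvalue[OF linear_mult unit_nonzero] by blast
  then have "(x - scale c \<ee>) \<odot> v = 0"
    by (simp add: op_diff_left op_scale_left unit_mult)
  then have "\<not> invertible (x - scale c \<ee>)"
    using invertible_cancel v(1) by blast
  then show ?thesis using augmentation_eqI by metis
qed

lemma augmentation_zero_iff: "augmentation x = 0 \<longleftrightarrow> \<not> invertible x"
  using not_invertible_augmentation[of x] augmentation_eqI[of x 0] by auto

lemma augmentation_unit: "augmentation \<ee> = 1"
  by (rule augmentation_eqI) (simp add: not_invertible_zero)

lemma augmentation_add: "augmentation (x + y) = augmentation x + augmentation y"
proof (rule augmentation_eqI)
  have "x + y - scale (augmentation x + augmentation y) \<ee> =
      (x - scale (augmentation x) \<ee>) + (y - scale (augmentation y) \<ee>)"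
    by (simp add: scale_left_distrib)
  then show "\<not> invertible (x + y - scale (augmentation x + augmentation y) \<ee>)"
    using not_invertible_add[OF not_invertible_augmentation not_invertible_augmentation] by metis
qed

lemma augmentation_scale: "augmentation (scale c x) = c * augmentation x"
proof (rule augmentation_eqI)
  have "scale c x - scale (c * augmentation x) \<ee> = scale c (x - scale (augmentation x) \<ee>)"
    by (simp add: scale_right_diff_distrib)
  then show "\<not> invertible (scale c x - scale (c * augmentation x) \<ee>)"
    using not_invertible_scale[OF not_invertible_augmentation] by metis
qed

lemma augmentation_mult: "augmentation (x \<odot> y) = augmentation x * augmentation y"
proof (rule augmentation_eqI)
  have "x \<odot> y - scale (augmentation x * augmentation y) \<ee> =
      x \<odot> (y - scale (augmentation y) \<ee>) + scale (augmentation y) (x - scale (augmentation x) \<ee>)"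
    by (simp add: op_diff_right op_scale_right mult_unit scale_right_diff_distrib mult.commute)
  moreover have "\<not> invertible (x \<odot> (y - scale (augmentation y) \<ee>))"
    using not_invertible_augmentation by (simp add: invertible_mult)
  ultimately show "\<not> invertible (x \<odot> y - scale (augmentation x * augmentation y) \<ee>)"
    using not_invertible_add[OF _ not_invertible_scale[OF not_invertible_augmentation]] by metis
qed

text \<open>No factorials are divided out, since the entries are coefficients with respect to
  divided powers.\<close>

definition taylor :: "'v \<Rightarrow> nat \<Rightarrow> 'f" where
  "taylor x k = augmentation ((D ^^ k) x)"

lemma taylor_add: "taylor (x + y) = taylor x + taylor y"
  by (simp add: fun_eq_iff taylor_def linear_selfD[OF linear_funpow[OF linear_D]] augmentation_add)

lemma taylor_scale: "taylor (scale c x) = fun_scale c (taylor x)"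
  by (simp add: fun_eq_iff taylor_def fun_scale_def linear_selfD[OF linear_funpow[OF linear_D]]
      augmentation_scale)

lemma taylor_D: "taylor (D x) = dp_deriv (taylor x)"
  by (simp add: fun_eq_iff taylor_def dp_deriv_def funpow_swap1)

lemma taylor_mult:
  "taylor (x \<odot> y) k = (\<Sum>j\<le>k. of_nat (k choose j) * taylor x (k - j) * taylor y j)"
proof (induction k arbitrary: x y)
  case 0
  then show ?case by (simp add: taylor_def augmentation_mult)
next
  case (Suc k)
  have "taylor (x \<odot> y) (Suc k) = taylor (D x \<odot> y) k + taylor (x \<odot> D y) k"
    using taylor_D[of "x \<odot> y"] by (simp add: dp_deriv_def fun_eq_iff D_mult taylor_add)
  then show ?case
    unfolding Suc.IH taylor_D sum_pascal by (simp add: dp_deriv_def)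
qed

text \<open>By the product and shift rules, the kernel of \<open>taylor\<close> is a
  \<open>D\<close>-stable ideal; it misses the unit.\<close>

lemma taylor_eq_0_imp:
  assumes "taylor x = 0"
  shows "x = 0"
proof -
  let ?J = "{x. \<forall>k. taylor x k = 0}"
  have "?J = {0} \<or> ?J = UNIV"
  proof (rule differentially_simple)
    show "subspace ?J"
    proof (rule subspaceI)
      show "0 \<in> ?J" using taylor_scale[of 0 0] by (simp add: fun_scale_def)
    qed (auto simp: taylor_add taylor_scale fun_scale_def)
  qed (auto simp: taylor_mult taylor_D dp_deriv_def)
  moreover have "\<ee> \<notin> ?J"
    using augmentation_unit by (auto simp: taylor_def intro!: exI[of _ 0])
  ultimately show ?thesis using assms by (auto simp: fun_eq_iff)
qed

text \<open>Subtracting the residue leaves a constant of \<open>D\<close> that is not invertible,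
  whereas nonzero constants are invertible.\<close>

lemma D_eq_0_imp:
  assumes "D x = 0"
  shows "x = scale (augmentation x) \<ee>"
proof (rule ccontr)
  let ?y = "x - scale (augmentation x) \<ee>"
  assume "x \<noteq> scale (augmentation x) \<ee>"
  then have "?y \<noteq> 0" by simp
  moreover have "D ?y = 0 \<odot> ?y"
    by (simp add: D_linear D_unit assms op_zero_left)
  ultimately have "invertible ?y" by (rule invertible_if_D_multiple)
  then show False using not_invertible_augmentation by blast
qed

lemma uniformly_nilpotent:
  assumes "gen_kernel D = UNIV"
  shows "\<exists>m. \<forall>x. (D ^^ m) x = 0"
proof -
  have "\<forall>x. \<exists>k. (D ^^ k) x = 0"
    using assms unfolding gen_kernel_def by blast
  then obtain k where k: "\<And>x. (D ^^ k x) x = 0" by metis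
  define m where "m = Max (k ` Basis)"
  have "k b \<le> m" if "b \<in> Basis" for b
    using that finite_Basis unfolding m_def by (intro Max_ge) auto
  then have m: "(D ^^ m) b = 0" if "b \<in> Basis" for b
    using funpow_zero_mono[OF linear_D k] that by blast
  note lin = linear_selfD[OF linear_funpow[OF linear_D, of m]]
  have "subspace {x. (D ^^ m) x = 0}"
    by (rule subspaceI) (simp_all add: lin(1-3))
  moreover have "Basis \<subseteq> {x. (D ^^ m) x = 0}"
    using m by blast
  ultimately have "span Basis \<subseteq> {x. (D ^^ m) x = 0}"
    by (intro span_minimal)
  then show ?thesis unfolding span_Basis by blast
qed

text \<open>\<open>N\<close> is the nilpotency index of \<open>D\<close>. With
  \<open>(D ^^ (N - 1)) y\<close> nonzero, that element is a nonzero scalar multiple of the unit, so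
  the iterates of \<open>y\<close> have Taylor sequences ending at each index below
  \<open>N\<close>, and triangular elimination gives surjectivity.\<close>

lemma taylor_nilpotent:
  assumes nil: "gen_kernel D = UNIV"
  obtains N where "N > 0" "range taylor = {f. \<forall>i\<ge>N. f i = 0}"
proof -
  define N where "N = (LEAST m. \<forall>x. (D ^^ m) x = 0)"
  have N: "(D ^^ N) x = 0" for x
    using LeastI_ex[OF uniformly_nilpotent[OF nil]] by (simp add: N_def)
  have "N \<noteq> 0"
  proof
    assume "N = 0"
    then show False using N[of \<ee>] unit_nonzero by simp
  qed
  then obtain M where M: "N = Suc M" by (cases N) auto
  have "\<not> (\<forall>x. (D ^^ M) x = 0)"
    using not_less_Least[of M "\<lambda>m. \<forall>x. (D ^^ m) x = 0"] M N_def by auto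
  then obtain y where y: "(D ^^ M) y \<noteq> 0" by blast
  have "D ((D ^^ M) y) = 0" using N[of y] by (simp add: M)
  then have aug: "augmentation ((D ^^ M) y) \<noteq> 0"
    using D_eq_0_imp y by (metis scale_zero_left)
  have top: "taylor ((D ^^ (M - m)) y) m \<noteq> 0" if "m \<le> M" for m
  proof -
    have "(D ^^ m) ((D ^^ (M - m)) y) = (D ^^ (m + (M - m))) y" by (simp only: funpow_add comp_apply)
    then show ?thesis using that aug by (simp add: taylor_def)
  qed
  have above: "taylor ((D ^^ (M - m)) y) i = 0" if "m \<le> M" "i > m" for m i
  proof -
    have "(D ^^ (i + (M - m))) y = 0"
      by (rule funpow_zero_mono[OF linear_D N]) (use that M in simp)
    then show ?thesis by (simp add: taylor_def funpow_add augmentation_zero_iff not_invertible_zero)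
  qed
  have surj: "f \<in> range taylor" if "m \<le> N" "\<forall>i\<ge>m. f i = 0" for f m
    using that
  proof (induction m arbitrary: f)
    case 0
    then have "f = taylor 0" using taylor_scale[of 0 0] by (simp add: fun_eq_iff fun_scale_def)
    then show ?case by blast
  next
    case (Suc m)
    then have mM: "m \<le> M" by (simp add: M)
    let ?z = "(D ^^ (M - m)) y"
    \<comment> \<open>Chosen to cancel the entry at \<open>m\<close>; the entries above
      \<open>m\<close> are already zero for both sequences.\<close>
    define c where "c = f m / taylor ?z m"
    have "\<forall>i\<ge>m. (f - taylor (scale c ?z)) i = 0"
    proof (intro allI impI)
      fix i assume "m \<le> i"
      then consider "i = m" | "i > m" by linarith
      then show "(f - taylor (scale c ?z)) i = 0"
        using Suc.prems(2) top[OF mM] above[OF mM, of i]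
        by cases (simp_all add: taylor_scale fun_scale_def c_def)
    qed
    then have "f - taylor (scale c ?z) \<in> range taylor"
      using Suc.prems(1) by (intro Suc.IH) auto
    then obtain x where "f - taylor (scale c ?z) = taylor x" by blast
    then have "f = taylor (x + scale c ?z)"
      by (simp add: taylor_add algebra_simps)
    then show ?case by blast
  qed
  have "taylor x i = 0" if "i \<ge> N" for x i
    using funpow_zero_mono[OF linear_D N that]
    by (simp add: taylor_def augmentation_zero_iff not_invertible_zero)
  then have "range taylor = {f. \<forall>i\<ge>N. f i = 0}"
    using surj[of N] by blast
  then show ?thesis using that \<open>N \<noteq> 0\<close> by blast
qed

lemma inj_taylor: "inj taylor"
proof (rule injI)
  fix x y assume "taylor x = taylor y"
  moreover have "taylor (x - y) + taylor y = taylor x" by (simp flip: taylor_add)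
  ultimately have "taylor (x - y) = 0" by simp
  then show "x = y" using taylor_eq_0_imp by force
qed

text \<open>The image is closed under the binomial convolution. Multiplying the unit sequences at
  \<open>N - j\<close> and \<open>j\<close> puts \<open>N choose j\<close> at index
  \<open>N\<close>, where every Taylor sequence vanishes; hence \<open>N\<close> is a power of the
  characteristic.\<close>

lemma taylor_bij:
  assumes nil: "gen_kernel D = UNIV" and char: "CHAR('f) > 0"
  obtains n where "bij_betw taylor UNIV (dp_carrier n)"
proof -
  obtain N where N: "N > 0" "range taylor = {f. \<forall>i\<ge>N. f i = 0}"
    using taylor_nilpotent[OF nil] by blast
  have "of_nat (N choose j) = (0::'f)" if "0 < j" "j < N" for j
  proof -
    define \<delta> where "\<delta> = (\<lambda>i k::nat. if k = i then 1 else 0 :: 'f)"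
    have "\<delta> (N - j) \<in> range taylor" "\<delta> j \<in> range taylor"
      using that by (auto simp: N(2) \<delta>_def)
    then obtain x y where xy: "taylor x = \<delta> (N - j)" "taylor y = \<delta> j"
      by (metis imageE)
    have "taylor (x \<odot> y) \<in> range taylor" by simp
    then have "0 = taylor (x \<odot> y) N" unfolding N(2) by simp
    also have "\<dots> = (\<Sum>l\<le>N. if l = j then of_nat (N choose j) else 0)"
      unfolding taylor_mult xy \<delta>_def by (rule sum.cong) (use that in auto)
    finally show ?thesis using that by simp
  qed
  then obtain n where "N = CHAR('f) ^ n"
    using choose_zero_imp_CHAR_power[OF N(1) char] by blast
  then show ?thesis
    using that[of n] N(2) inj_taylor by (simp add: bij_betw_def dp_carrier_def)
qed

section \<open>Rescaling the derivation by an invertible element\<close>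

lemma change_derivation:
  assumes "invertible w"
  shows "simple_differential_algebra scale (\<odot>) Basis \<ee> (\<lambda>x. w \<odot> D x)"
proof (intro simple_differential_algebra.intro simple_differential_algebra_axioms.intro)
  \<comment> \<open>The inverse \<open>s\<close> recovers \<open>D\<close> from its multiple, so
    both derivations have the same stable ideals.\<close>
  obtain s where s: "w \<odot> s = \<ee>" using assms by (auto simp: invertible_def)
  show "Vector_Spaces.linear scale scale (\<lambda>x. w \<odot> D x)"
    by (simp add: linear_self_iff D_linear op_bilinear)
  show "w \<odot> D (x \<odot> y) = w \<odot> D x \<odot> y + x \<odot> (w \<odot> D y)" for x y
    by (simp add: D_mult op_add_right mult_ac)
  show "J = {0} \<or> J = UNIV" if "subspace J" "\<And>a x. x \<in> J \<Longrightarrow> a \<odot> x \<in> J"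
    "\<And>x. x \<in> J \<Longrightarrow> w \<odot> D x \<in> J" for J
  proof (rule differentially_simple[OF that(1,2)])
    fix x assume "x \<in> J"
    then have "s \<odot> (w \<odot> D x) \<in> J" using that by blast
    moreover have "s \<odot> (w \<odot> D x) = D x" by (metis mult_assoc mult_commute s unit_mult)
    ultimately show "D x \<in> J" by simp
  qed
qed (simp_all add: unit_mult unit_nonzero comm_assoc_algebra_axioms fin_dim_alg_closed_axioms)

text \<open>The operator \<open>(D - c) (D - 2 c) ... (D - m c)\<close>. The factor \<open>D\<close>
  itself is left out; it enters by applying the operator to \<open>D x\<close>.\<close>

primrec shifted_product :: "'f \<Rightarrow> nat \<Rightarrow> 'v \<Rightarrow> 'v" where
  "shifted_product c 0 x = x"
| "shifted_product c (Suc m) x =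
     D (shifted_product c m x) - scale (of_nat (Suc m) * c) (shifted_product c m x)"

lemma funpow_D_shifted_product:
  "(D ^^ k) (shifted_product c m x) = shifted_product c m ((D ^^ k) x)"
  by (induction m)
    (simp_all add: linear_selfD[OF linear_funpow[OF linear_D]] flip: funpow_swap1)

lemma shifted_product_zero: "shifted_product c m 0 = 0"
  by (induction m) (simp_all add: D_linear)

text \<open>
  With \<open>E = r D\<close> one has \<open>E\<^sup>m = r\<^sup>m D (D - c) \<dots> (D - (m - 1) c)\<close>; in characteristic \<open>p\<close> the
  element \<open>r\<^sup>p\<close> is a constant of \<open>D\<close>, so \<open>E\<^sup>p\<close> lowers the nilpotency order on the generalized
  null space of \<open>D\<close>.
\<close>
lemma gen_kernel_psubset:
  assumes char: "CHAR('f) > 0" and c: "c \<noteq> 0" and t: "D t = scale c t" and r: "t \<odot> r = \<ee>"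
  shows "gen_kernel D \<subset> gen_kernel (\<lambda>x. r \<odot> D x)"
proof -
  define E where "E = (\<lambda>x. r \<odot> D x)"
  define rp where "rp = (\<lambda>m. ((\<odot>) r ^^ m) \<ee>)"
  have rp_Suc: "rp (Suc m) = r \<odot> rp m" for m by (simp add: rp_def)
  have "t \<odot> D r = - scale c \<ee>"
    using D_mult[of t r] unfolding r D_unit t op_scale_left by (simp add: eq_neg_iff_add_eq_0 add.commute)
  then have "r \<odot> (t \<odot> D r) = - scale c r"
    by (simp add: op_minus_right op_scale_right mult_unit)
  then have Dr: "D r = - scale c r"
    by (metis mult_assoc mult_commute r unit_mult)
  have Drp: "D (rp m) = scale (- (of_nat m * c)) (rp m)" for m
  proof (induction m)
    case 0
    then show ?case by (simp add: rp_def D_unit)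
  next
    case (Suc m)
    then show ?case
      by (simp add: rp_Suc D_mult Dr op_bilinear scale_left_diff_distrib algebra_simps)
  qed
  have E_pow: "(E ^^ Suc m) x = rp (Suc m) \<odot> shifted_product c m (D x)" for m x
  proof (induction m)
    case 0
    then show ?case by (simp add: rp_def E_def mult_unit)
  next
    case (Suc m)
    have "(E ^^ Suc (Suc m)) x = E (rp (Suc m) \<odot> shifted_product c m (D x))"
      unfolding Suc.IH[symmetric] by simp
    then show ?case
      by (simp add: E_def D_mult Drp rp_Suc[of "Suc m"] op_bilinear mult_assoc del: of_nat_Suc)
  qed
  have linE: "Vector_Spaces.linear scale scale E"
    by (simp add: E_def linear_self_iff D_linear op_bilinear)
  \<comment> \<open>Here \<open>p\<close> is one less than the characteristic, so that
    \<open>E_pow\<close> applies to the power \<open>Suc p\<close>; the factor \<open>Suc p\<close>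
    in \<open>Drp\<close> vanishes.\<close>
  obtain p where p: "CHAR('f) = Suc p" using char by (cases "CHAR('f)") auto
  have D_rp_char: "D (rp (Suc p)) = 0"
    unfolding Drp by (simp add: p[symmetric] del: of_nat_Suc)
  have E_rp_char: "(E ^^ m) (rp (Suc p) \<odot> x) = rp (Suc p) \<odot> (E ^^ m) x" for m x
  proof (induction m)
    case (Suc m)
    have "E (rp (Suc p) \<odot> y) = rp (Suc p) \<odot> E y" for y
      by (simp add: E_def D_mult D_rp_char op_zero_left mult_left_commute)
    then show ?case by (simp add: Suc)
  qed simp
  have sub: "x \<in> gen_kernel E" if "(D ^^ k) x = 0" for k x
    using that
  proof (induction k arbitrary: x)
    case 0
    then show ?case using subspace_0[OF subspace_gen_kernel[OF linE]] by simp
  next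
    case (Suc k)
    \<comment> \<open>Since \<open>shifted_product\<close> commutes with \<open>D\<close>, the
      induction hypothesis covers \<open>?u\<close>; \<open>(E ^^ Suc p) x\<close> is
      \<open>?u\<close> times an element that passes through \<open>E\<close>.\<close>
    let ?u = "shifted_product c p (D x)"
    have "(D ^^ k) ?u = 0"
      using Suc.prems by (simp add: funpow_D_shifted_product shifted_product_zero funpow_swap1)
    then obtain m where "(E ^^ m) ?u = 0"
      using Suc.IH by (auto simp: gen_kernel_def)
    then have "(E ^^ m) ((E ^^ Suc p) x) = 0"
      unfolding E_pow E_rp_char by (simp add: op_zero_right)
    then have "(E ^^ (m + Suc p)) x = 0" by (simp only: funpow_add comp_apply)
    then show ?case by (rule gen_kernelI)
  qed
  \<comment> \<open>Strictness: \<open>E\<close> sends \<open>t\<close> to a scalar multiple of the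
    unit and then to zero, while \<open>D\<close> only rescales \<open>t\<close> by the nonzero
    \<open>c\<close>.\<close>
  have "E t = scale c \<ee>"
    by (simp add: E_def t op_scale_left mult_commute[of r] r)
  then have "(E ^^ 2) t = 0"
    by (simp add: numeral_2_eq_2 E_def D_linear D_unit op_zero_right)
  then have "t \<in> gen_kernel E" by (rule gen_kernelI)
  moreover have "t \<notin> gen_kernel D"
  proof -
    have "t \<noteq> 0" using r unit_nonzero by (auto simp: op_zero_left)
    moreover have "(D ^^ k) t = scale (c ^ k) t" for k
      by (induction k) (simp_all add: D_linear t mult.commute)
    ultimately show ?thesis using c by (simp add: gen_kernel_def)
  qed
  moreover have "gen_kernel D \<subseteq> gen_kernel E"
    using sub by (auto simp: gen_kernel_def[of D])
  ultimately show ?thesis unfolding E_def by blast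
qed

text \<open>Induction on the codimension of the generalized null space, starting from the unit as
  multiplier; each step multiplies by the inverse of an eigenvector with nonzero eigenvalue.\<close>

lemma exists_nilpotent_multiple:
  assumes char: "CHAR('f) > 0"
  shows "\<exists>w. invertible w \<and> gen_kernel (\<lambda>x. w \<odot> D x) = UNIV"
proof -
  have "\<exists>w. invertible w \<and> gen_kernel (\<lambda>x. w \<odot> D x) = UNIV" if "invertible v" for v
    using that
  proof (induction "dimension - dim (gen_kernel (\<lambda>x. v \<odot> D x))" arbitrary: v rule: less_induct)
    case less
    interpret T: simple_differential_algebra scale "(\<odot>)" Basis \<ee> "\<lambda>x. v \<odot> D x"
      by (rule change_derivation[OF less.prems])
    let ?T = "\<lambda>x. v \<odot> D x"
    show ?case
    proof (cases "gen_kernel ?T = UNIV")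
      case True
      then show ?thesis using less.prems by blast
    next
      case False
      then obtain c t where ct: "c \<noteq> 0" "t \<noteq> 0" "?T t = scale c t"
        using exists_nonzero_eigenvalue[OF T.linear_D] by blast
      have "invertible t"
        by (rule T.invertible_if_D_multiple[OF ct(2), of "scale c \<ee>", folded T.invertible_def invertible_def])
          (simp add: ct(3) op_scale_left unit_mult)
      then obtain r where r: "t \<odot> r = \<ee>" by (auto simp: invertible_def)
      have sub: "gen_kernel ?T \<subset> gen_kernel (\<lambda>x. (r \<odot> v) \<odot> D x)"
        using T.gen_kernel_psubset[OF char ct(1,3) r] by (simp add: mult_assoc)
      have inv: "invertible (r \<odot> v)"
        using less.prems r mult_commute[of r t] unfolding invertible_mult by (auto simp: invertible_def)
      interpret T': simple_differential_algebra scale "(\<odot>)" Basis \<ee> "\<lambda>x. (r \<odot> v) \<odot> D x"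
        by (rule change_derivation[OF inv])
      have "dim (gen_kernel ?T) < dim (gen_kernel (\<lambda>x. (r \<odot> v) \<odot> D x))"
      proof (rule dim_psubset)
        show "span (gen_kernel ?T) \<subset> span (gen_kernel (\<lambda>x. (r \<odot> v) \<odot> D x))"
          using sub subspace_gen_kernel[OF T.linear_D] subspace_gen_kernel[OF T'.linear_D]
          by (metis span_eq_iff)
      qed
      then have "dimension - dim (gen_kernel (\<lambda>x. (r \<odot> v) \<odot> D x)) < dimension - dim (gen_kernel ?T)"
        using dim_subset_UNIV[of "gen_kernel (\<lambda>x. (r \<odot> v) \<odot> D x)"] by linarith
      from less.hyps[OF this inv] show ?thesis .
    qed
  qed
  moreover have "invertible \<ee>" using unit_mult by (auto simp: invertible_def)
  ultimately show ?thesis by blast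
qed

lemma dp_mult_taylor:
  assumes "range taylor \<subseteq> dp_carrier n"
  shows "dp_mult n (taylor x) (taylor y) = taylor (x \<odot> y)"
proof
  fix k
  have "taylor (x \<odot> y) \<in> dp_carrier n" using assms by blast
  then show "dp_mult n (taylor x) (taylor y) k = taylor (x \<odot> y) k"
    by (simp add: dp_mult_def dp_carrier_def taylor_mult)
qed

lemma lie_isomorphic_zassenhaus:
  assumes char: "CHAR('f) > 0" and nontrivial: "\<exists>x. D x \<noteq> 0"
    and bracket: "\<And>y z. bracket y z = y \<odot> D z - z \<odot> D y"
  shows "\<exists>n\<ge>1. lie_isomorphic scale bracket fun_scale (dp_carrier n) (zassenhaus_bracket n)"
proof -
  obtain w where w: "invertible w" "gen_kernel (\<lambda>x. w \<odot> D x) = UNIV"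
    using exists_nilpotent_multiple[OF char] by blast
  obtain s where s: "w \<odot> s = \<ee>" using w(1) by (auto simp: invertible_def)
  have cancel: "w \<odot> (s \<odot> x) = x" "s \<odot> (w \<odot> x) = x" for x
    using s by (metis mult_assoc mult_commute unit_mult)+
  interpret T: simple_differential_algebra scale "(\<odot>)" Basis \<ee> "\<lambda>x. w \<odot> D x"
    by (rule change_derivation[OF w(1)])
  obtain n where n: "bij_betw T.taylor UNIV (dp_carrier n)"
    using T.taylor_bij[OF w(2) char] by blast
  then have range: "range T.taylor \<subseteq> dp_carrier n" by (simp add: bij_betw_def)
  \<comment> \<open>The formal vector field \<open>y D\<close> equals
    \<open>(s \<odot> y) (w D)\<close>, so \<open>s \<odot> y\<close> is its coefficient with
    respect to the nilpotent derivation.\<close>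
  define \<phi> where "\<phi> = (\<lambda>y. T.taylor (s \<odot> y))"
  \<comment> \<open>Sequences in \<open>dp_carrier 0\<close> live at index 0 and are killed by the
    shift, which would make \<open>D\<close> zero.\<close>
  have "n \<noteq> 0"
  proof
    assume "n = 0"
    obtain x where x: "D x \<noteq> 0" using nontrivial by blast
    have "T.taylor x \<in> dp_carrier 0" using range \<open>n = 0\<close> by blast
    then have "T.taylor (w \<odot> D x) = 0"
      unfolding T.taylor_D by (simp add: dp_carrier_def dp_deriv_def fun_eq_iff)
    then have "w \<odot> D x = 0" by (rule T.taylor_eq_0_imp)
    then show False using x invertible_cancel[OF w(1)] by blast
  qed
  moreover have "Vector_Spaces.linear scale fun_scale \<phi>"
    by (simp add: Vector_Spaces.linear_iff vector_space_axioms vector_space_fun_scale \<phi>_def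
        op_add_right op_scale_right T.taylor_add T.taylor_scale)
  moreover have "bij_betw \<phi> UNIV (dp_carrier n)"
  proof -
    have "bij ((\<odot>) s)"
      by (rule bij_betw_byWitness[where f' = "(\<odot>) w"]) (auto simp: cancel)
    then show ?thesis
      using bij_betw_trans[OF _ n, of "(\<odot>) s" UNIV] by (simp add: \<phi>_def comp_def)
  qed
  moreover have "\<phi> (bracket x y) = zassenhaus_bracket n (\<phi> x) (\<phi> y)" for x y
  proof -
    \<comment> \<open>The term with \<open>D s\<close> is symmetric in \<open>a\<close> and
      \<open>b\<close>, hence drops out of the bracket.\<close>
    have *: "(s \<odot> a) \<odot> (w \<odot> D (s \<odot> b)) = (a \<odot> b) \<odot> D s + s \<odot> (a \<odot> D b)" for a b
    proof -
      have "(s \<odot> a) \<odot> (w \<odot> D (s \<odot> b)) = w \<odot> (s \<odot> (a \<odot> D (s \<odot> b)))"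
        by (simp add: mult_ac)
      also have "\<dots> = a \<odot> (D s \<odot> b) + a \<odot> (s \<odot> D b)"
        by (simp add: cancel D_mult op_add_right)
      finally show ?thesis by (simp add: mult_ac)
    qed
    have "zassenhaus_bracket n (\<phi> x) (\<phi> y) =
        T.taylor ((s \<odot> x) \<odot> (w \<odot> D (s \<odot> y))) - T.taylor ((s \<odot> y) \<odot> (w \<odot> D (s \<odot> x)))"
      unfolding zassenhaus_bracket_def \<phi>_def T.taylor_D[symmetric] T.dp_mult_taylor[OF range]
      by (simp add: mult_commute)
    also have "\<dots> = T.taylor ((s \<odot> x) \<odot> (w \<odot> D (s \<odot> y)) - (s \<odot> y) \<odot> (w \<odot> D (s \<odot> x)))"
      using T.taylor_add[of "(s \<odot> x) \<odot> (w \<odot> D (s \<odot> y)) - (s \<odot> y) \<odot> (w \<odot> D (s \<odot> x))"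
          "(s \<odot> y) \<odot> (w \<odot> D (s \<odot> x))"] by simp
    also have "\<dots> = \<phi> (bracket x y)"
      by (simp add: * bracket \<phi>_def op_diff_right mult_commute[of y x])
    finally show ?thesis by simp
  qed
  ultimately show ?thesis
    unfolding lie_isomorphic_def by (metis One_nat_def Suc_leI neq0_conv)
qed

end

section \<open>Simple transposed Poisson algebras\<close>

context transposed_poisson_algebra
begin

lemma half_derivation_mult: "half_derivation (mult x)"
proof -
  have "mult x (bracket y z) + mult x (bracket y z) = bracket (mult x y) z + bracket y (mult x z)" for y z
    using transposed_leibniz[of x y z] by (metis one_add_one scale_left_distrib scale_one)
  then show ?thesis
    unfolding half_derivation_def using comm_assoc_algebra.axioms(1)[OF comm_assoc_algebra_axioms]
    by (simp add: bilinear_operation.linear_right)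
qed

lemma compatible_mult: "compatible (mult x) (mult y)"
proof -
  have "mult x (mult y z) = mult (mult x y) z" "mult x (mult y z) = mult y (mult x z)" for z
    by (metis mult_assoc mult_commute)+
  then show ?thesis
    using half_derivation_mult by (simp add: compatible_def)
qed

text \<open>Closure under commutators with ad z is what makes null spaces and common kernels stable
  under the bracket.\<close>

inductive mult_derived :: "('v \<Rightarrow> 'v) \<Rightarrow> bool" where
  mult: "mult_derived (mult x)"
| ad_commutator: "mult_derived \<phi> \<Longrightarrow> mult_derived (ad_commutator z \<phi>)"

text \<open>Two inductions: first one operator is derived while the other is a multiplication, then
  the second is derived too.\<close>

lemma mult_derived_compatible:
  assumes "CHAR('f) \<noteq> 3" "mult_derived \<phi>" "mult_derived \<psi>"
  shows "compatible \<phi> \<psi>"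
proof -
  note step = compatible_ad_commutator[OF char_neq_2 assms(1)]
  have base: "compatible \<psi> (mult x)" for x
    using assms(3) by induction (auto intro: compatible_mult step)
  from assms(2) show ?thesis
    by induction (auto intro: base step compatible_sym)
qed

text \<open>Every operator of the class is itself a multiplication of some commutative product, with
  all multiplications in the class. The element \<open>u\<close> later becomes the unit.\<close>

lemma mult_derived_family:
  assumes "CHAR('f) \<noteq> 3" "mult_derived \<phi>"
  obtains B u where "\<phi> = B u" "\<And>x. mult_derived (B x)" "\<And>x y. B x y = B y x"
  using assms(2)
proof cases
  case (mult x)
  then show ?thesis using that[of mult x] mult_derived.mult mult_commute by blast
next
  case (ad_commutator \<chi> z)
  have "half_derivation \<chi>"
    using mult_derived_compatible[OF assms(1)] ad_commutator(2) by (auto simp: compatible_def)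
  then show ?thesis
    using that[of "\<lambda>z. ad_commutator z \<chi>" z] ad_commutator ad_commutator_commute
      mult_derived.ad_commutator by blast
qed

end

section \<open>From simplicity to a unital product\<close>

locale simple_transposed_poisson_algebra =
  transposed_poisson_algebra scale mult bracket + fin_dim_alg_closed scale Basis
  for scale :: "'f::alg_closed_field \<Rightarrow> 'v::ab_group_add \<Rightarrow> 'v"
    and mult bracket :: "'v \<Rightarrow> 'v \<Rightarrow> 'v"
    and Basis :: "'v set" +
  assumes char_neq_3: "CHAR('f) \<noteq> 3"
    and is_simple: simple
    and is_nontrivial: "\<not> trivial"
begin

lemma UNIV_nonzero: "(UNIV :: 'v set) \<noteq> {0}"
  using is_simple unfolding simple_def by metis

lemma ideal_cases: "ideal I \<Longrightarrow> I = {0} \<or> I = UNIV"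
  using is_simple by (auto simp: simple_def)

lemma derived_compatible: "mult_derived \<phi> \<Longrightarrow> mult_derived \<psi> \<Longrightarrow> compatible \<phi> \<psi>"
  by (rule mult_derived_compatible[OF char_neq_3])

lemma derived_commute:
  assumes "mult_derived \<phi>" "mult_derived \<psi>"
  shows "\<phi> (\<psi> x) = \<psi> (\<phi> x)"
  using derived_compatible[OF assms] by (simp add: compatible_def)

lemma derived_half_derivation: "mult_derived \<phi> \<Longrightarrow> half_derivation \<phi>"
  using derived_compatible by (auto simp: compatible_def)

lemma derived_linear: "mult_derived \<phi> \<Longrightarrow> Vector_Spaces.linear scale scale \<phi>"
  using derived_half_derivation by (simp add: half_derivation_def)

lemma idealI:
  assumes "subspace I" "\<And>x y. y \<in> I \<Longrightarrow> mult x y \<in> I" "\<And>x y. y \<in> I \<Longrightarrow> bracket x y \<in> I"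
  shows "ideal I"
proof -
  have "bracket y x \<in> I" "mult y x \<in> I" if "y \<in> I" for x y
    using assms that by (metis bracket_swap subspace_neg, metis mult_commute)
  then show ?thesis using assms by (simp add: ideal_def)
qed

lemma funpow_derived_commute:
  assumes "mult_derived \<phi>" "mult_derived \<psi>"
  shows "(\<phi> ^^ k) (\<psi> x) = \<psi> ((\<phi> ^^ k) x)"
  by (induction k) (simp_all add: derived_commute[OF assms])

text \<open>Stability under the bracket is by induction on the exponent:
  \<open>\<phi> [z, y]\<close> is \<open>[z, \<phi> y]\<close> minus a derived operator applied to
  \<open>y\<close>.\<close>

lemma gen_kernel_derived_cases:
  assumes \<phi>: "mult_derived \<phi>"
  shows "gen_kernel \<phi> = {0} \<or> gen_kernel \<phi> = UNIV"
proof (rule ideal_cases, rule idealI)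
  note lin = derived_linear[OF \<phi>]
  show sub: "subspace (gen_kernel \<phi>)" by (rule subspace_gen_kernel[OF lin])
  have stable: "\<psi> y \<in> gen_kernel \<phi>" if "mult_derived \<psi>" "y \<in> gen_kernel \<phi>" for \<psi> y
  proof -
    from that(2) obtain k where "(\<phi> ^^ k) y = 0" by (auto simp: gen_kernel_def)
    then have "(\<phi> ^^ k) (\<psi> y) = 0"
      using linear_selfD(3)[OF derived_linear[OF that(1)]]
      by (simp add: funpow_derived_commute[OF \<phi> that(1)])
    then show ?thesis by (rule gen_kernelI)
  qed
  show "mult x y \<in> gen_kernel \<phi>" if "y \<in> gen_kernel \<phi>" for x y
    using stable[OF mult_derived.mult that] .
  show "bracket z y \<in> gen_kernel \<phi>" if "y \<in> gen_kernel \<phi>" for z y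
  proof -
    from that obtain k where "(\<phi> ^^ k) y = 0" by (auto simp: gen_kernel_def)
    then show ?thesis
    proof (induction k arbitrary: y)
      case 0
      then show ?case using subspace_0[OF sub] by (simp add: bracket_zero_right)
    next
      case (Suc k)
      then have k: "(\<phi> ^^ k) (\<phi> y) = 0" by (simp add: funpow_swap1)
      then have "y \<in> gen_kernel \<phi>"
        using gen_kernelI gen_kernel_apply_iff[OF lin] by metis
      then have "ad_commutator z \<phi> y \<in> gen_kernel \<phi>"
        by (rule stable[OF mult_derived.ad_commutator[OF \<phi>]])
      then have "\<phi> (bracket z y) \<in> gen_kernel \<phi>"
        unfolding bracket_eq_ad_commutator using Suc.IH[OF k] by (intro subspace_diff[OF sub])
      then show ?case using gen_kernel_apply_iff[OF lin] by blast
    qed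
  qed
qed

lemma exists_injective_derived: "\<exists>\<phi>. mult_derived \<phi> \<and> gen_kernel \<phi> = {0}"
proof (rule ccontr)
  assume "\<not> ?thesis"
  then have nil: "gen_kernel \<phi> = UNIV" if "mult_derived \<phi>" for \<phi>
    using gen_kernel_derived_cases that by blast
  \<comment> \<open>In a stable subspace \<open>W\<close> of least positive dimension, the kernel of
    each nilpotent operator is nonzero and again stable, so every operator vanishes on
    \<open>W\<close>.\<close>
  let ?P = "\<lambda>W. subspace W \<and> W \<noteq> {0} \<and> (\<forall>\<phi>. mult_derived \<phi> \<longrightarrow> \<phi> ` W \<subseteq> W)"
  have "?P UNIV" using UNIV_nonzero by simp
  then have "\<exists>W. ?P W \<and> (\<forall>V. ?P V \<longrightarrow> dim W \<le> dim V)"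
    by (rule ex_has_least_nat)
  then obtain W where W: "?P W" and W_min: "\<And>V. ?P V \<Longrightarrow> dim W \<le> dim V"
    by iprover
  have W_sub: "subspace W" and "W \<noteq> {0}"
    and W_stable: "\<And>\<phi> w. mult_derived \<phi> \<Longrightarrow> w \<in> W \<Longrightarrow> \<phi> w \<in> W"
    using W by (simp_all add: image_subset_iff)
  then obtain x where x: "x \<in> W" "x \<noteq> 0"
    using subspace_0[OF W_sub] by blast
  have killed: "\<phi> v = 0" if \<phi>: "mult_derived \<phi>" and "v \<in> W" for \<phi> v
  proof -
    note lin = linear_selfD[OF derived_linear[OF \<phi>]]
    define V where "V = W \<inter> {v. \<phi> v = 0}"
    have "subspace {v. \<phi> v = 0}"
      by (rule subspaceI) (simp_all add: lin(1-3))
    then have V_sub: "subspace V"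
      unfolding V_def by (rule subspace_inter[OF W_sub])
    have "V \<noteq> {0}"
    proof -
      have "x \<in> gen_kernel \<phi>" using nil[OF \<phi>] by simp
      then obtain k where k: "(\<phi> ^^ k) x \<noteq> 0" "\<phi> ((\<phi> ^^ k) x) = 0"
        using gen_kernel_obtain_kernel x(2) by metis
      have "(\<phi> ^^ k) x \<in> W"
        using x(1) by (induction k) (simp_all add: W_stable[OF \<phi>])
      with k show ?thesis by (auto simp: V_def)
    qed
    moreover have "\<psi> ` V \<subseteq> V" if \<psi>: "mult_derived \<psi>" for \<psi>
    proof -
      have "\<phi> (\<psi> v) = 0" if "\<phi> v = 0" for v
        using that linear_selfD(3)[OF derived_linear[OF \<psi>]]
        by (simp add: derived_commute[OF \<phi> \<psi>])
      then show ?thesis using W_stable[OF \<psi>] by (auto simp: V_def)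
    qed
    ultimately have "dim W \<le> dim V" using V_sub by (intro W_min) simp
    then have "V = W"
      using V_sub W_sub by (intro subspace_dim_equal) (auto simp: V_def)
    then show ?thesis using that(2) by (auto simp: V_def)
  qed
  let ?Z = "{v. \<forall>\<phi>. mult_derived \<phi> \<longrightarrow> \<phi> v = 0}"
  have "ideal ?Z"
  proof (rule idealI)
    show "subspace ?Z"
    proof (rule subspaceI)
      show "0 \<in> ?Z" using linear_selfD(3)[OF derived_linear] by blast
      show "x + y \<in> ?Z" if "x \<in> ?Z" "y \<in> ?Z" for x y
      proof (intro CollectI allI impI)
        fix \<phi> assume \<phi>: "mult_derived \<phi>"
        then have "\<phi> x = 0" "\<phi> y = 0" using that by blast+
        then show "\<phi> (x + y) = 0" using linear_selfD(1)[OF derived_linear[OF \<phi>]] by simp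
      qed
      show "scale c x \<in> ?Z" if "x \<in> ?Z" for c x
      proof (intro CollectI allI impI)
        fix \<phi> assume \<phi>: "mult_derived \<phi>"
        then have "\<phi> x = 0" using that by blast
        then show "\<phi> (scale c x) = 0" using linear_selfD(2)[OF derived_linear[OF \<phi>]] by simp
      qed
    qed
    show "mult x y \<in> ?Z" if "y \<in> ?Z" for x y
    proof (intro CollectI allI impI)
      have "mult x y = 0" using that mult_derived.mult[of x] by blast
      fix \<phi> assume "mult_derived \<phi>"
      then show "\<phi> (mult x y) = 0"
        using \<open>mult x y = 0\<close> linear_selfD(3)[OF derived_linear, of \<phi>] by simp
    qed
    show "bracket x y \<in> ?Z" if "y \<in> ?Z" for x y
    proof (intro CollectI allI impI)
      fix \<phi> assume \<phi>: "mult_derived \<phi>"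
      have "\<phi> y = 0" "ad_commutator x \<phi> y = 0"
        using that \<phi> mult_derived.ad_commutator[OF \<phi>] by blast+
      then show "\<phi> (bracket x y) = 0"
        unfolding bracket_eq_ad_commutator[of \<phi> x y] by (simp add: bracket_zero_right)
    qed
  qed
  moreover have "?Z \<noteq> {0}"
    using killed x by blast
  ultimately have "?Z = UNIV" using ideal_cases by blast
  then have "mult x y = 0" for x y
    using mult_derived.mult[of x] by blast
  then show False using is_nontrivial by (simp add: trivial_def)
qed

text \<open>The product \<open>B x y\<close> is divided by the bijective operator
  \<open>B u\<close>; commutation within the class gives associativity, and \<open>u\<close> becomes
  the unit.\<close>

lemma exists_unital_product:
  obtains prod u where
    "simple_differential_algebra scale prod Basis u (bracket u)"
    "\<And>y z. bracket y z = prod y (bracket u z) - prod z (bracket u y)"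
proof -
  obtain \<phi> where \<phi>: "mult_derived \<phi>" "gen_kernel \<phi> = {0}"
    using exists_injective_derived by blast
  obtain B u where B: "\<phi> = B u" "\<And>x. mult_derived (B x)" and B_sym: "\<And>x y. B x y = B y x"
    using mult_derived_family[OF char_neq_3 \<phi>(1)] by blast
  note lin = linear_selfD[OF derived_linear[OF \<phi>(1)]]
  note B_lin = linear_selfD[OF derived_linear[OF B(2)]]
  have "inj \<phi>"
    by (rule gen_kernel_trivial_imp_inj[OF derived_linear[OF \<phi>(1)] \<phi>(2)])
  moreover from this have "surj \<phi>"
    by (rule linear_inj_imp_surj[OF derived_linear[OF \<phi>(1)]])
  ultimately have inv: "inv \<phi> (\<phi> x) = x" "\<phi> (inv \<phi> x) = x" for x
    by (simp_all add: surj_f_inv_f)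
  have inv_eqI: "inv \<phi> x = y" if "x = \<phi> y" for x y
    by (simp add: that inv)
  have inv_lin: "inv \<phi> (x + y) = inv \<phi> x + inv \<phi> y" "inv \<phi> (scale c x) = scale c (inv \<phi> x)" for x y c
    by (rule inv_eqI, simp add: lin inv)+
  have inv_commute: "inv \<phi> (\<psi> x) = \<psi> (inv \<phi> x)" if "mult_derived \<psi>" for \<psi> x
    by (rule inv_eqI) (simp add: derived_commute[OF \<phi>(1) that] inv)
  have bracket_inv: "inv \<phi> (bracket x y) = \<phi> (bracket (inv \<phi> x) (inv \<phi> y))" for x y
  proof (rule inv_eqI, rule double_cancel[OF char_neq_2])
    show "bracket x y + bracket x y = \<phi> (\<phi> (bracket (inv \<phi> x) (inv \<phi> y))) +
        \<phi> (\<phi> (bracket (inv \<phi> x) (inv \<phi> y)))"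
      using compatible_bracket[OF derived_compatible[OF \<phi>(1) \<phi>(1)], of "inv \<phi> x" "inv \<phi> y"]
      by (simp add: inv)
  qed
  define prod where "prod = (\<lambda>x y. inv \<phi> (B x y))"
  have prod_commute: "prod x y = prod y x" for x y
    by (simp add: prod_def B_sym[of x])
  have prod_assoc: "prod (prod x y) z = prod x (prod y z)" for x y z
  proof -
    have "prod (prod x y) z = prod z (prod x y)" by (rule prod_commute)
    also have "\<dots> = prod x (prod z y)"
      by (simp add: prod_def inv_commute[OF B(2)] derived_commute[OF B(2) B(2), of z x])
    finally show ?thesis by (simp add: prod_commute[of z])
  qed
  have prod_unit: "prod u x = x" for x
    by (simp add: prod_def inv B(1)[symmetric])
  have prod_lin: "prod x (y + z) = prod x y + prod x z" "prod x (scale c y) = scale c (prod x y)" for x y z c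
    by (simp_all add: prod_def B_lin inv_lin)
  have prod_half: "prod x (bracket y z) + prod x (bracket y z) =
      bracket (prod x y) z + bracket y (prod x z)" for x y z
  proof -
    have "bracket (B x (inv \<phi> y)) z + bracket y (B x (inv \<phi> z)) =
        B x (\<phi> (bracket (inv \<phi> y) (inv \<phi> z))) + B x (\<phi> (bracket (inv \<phi> y) (inv \<phi> z)))"
      using compatible_bracket[OF derived_compatible[OF B(2) \<phi>(1)], of x "inv \<phi> y" "inv \<phi> z"]
      by (simp add: inv)
    then show ?thesis
      by (simp add: prod_def inv_commute[OF B(2)] bracket_inv)
  qed
  have prod_D: "prod y (bracket u z) + prod y (bracket u z) = bracket y z + bracket u (prod y z)" for y z
    using prod_half[of y u z] prod_commute[of y u] by (simp add: prod_unit)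
  \<comment> \<open>Adding \<open>prod_D\<close> to its version with the arguments exchanged cancels
    the bracket; subtracting the two instead yields \<open>bracket_eq\<close>.\<close>
  have D_prod: "bracket u (prod x y) = prod (bracket u x) y + prod x (bracket u y)" for x y
  proof (rule double_cancel[OF char_neq_2])
    show "bracket u (prod x y) + bracket u (prod x y) =
        prod (bracket u x) y + prod x (bracket u y) + (prod (bracket u x) y + prod x (bracket u y))"
      using prod_D[of x y] prod_D[of y x] bracket_swap[of x y]
      by (simp add: prod_commute[of _ y] algebra_simps)
  qed
  have bracket_eq: "bracket y z = prod y (bracket u z) - prod z (bracket u y)" for y z
  proof (rule double_cancel[OF char_neq_2])
    have "prod y (bracket u z) - prod z (bracket u y) + (prod y (bracket u z) - prod z (bracket u y)) =
      (prod y (bracket u z) + prod y (bracket u z)) - (prod z (bracket u y) + prod z (bracket u y))"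
      by simp
    also have "\<dots> = bracket y z + bracket y z"
      unfolding prod_D by (simp add: prod_commute[of z y] bracket_swap[of z y])
    finally show "bracket y z + bracket y z =
      prod y (bracket u z) - prod z (bracket u y) + (prod y (bracket u z) - prod z (bracket u y))" by simp
  qed
  have linear_prod: "Vector_Spaces.linear scale scale (prod x)" for x
    by (simp add: linear_self_iff prod_lin)
  have "simple_differential_algebra scale prod Basis u (bracket u)"
  proof (intro simple_differential_algebra.intro simple_differential_algebra_axioms.intro
      comm_assoc_algebra.intro comm_assoc_algebra_axioms.intro bilinear_operation.intro
      bilinear_operation_axioms.intro)
    show "Vector_Spaces.linear scale scale (\<lambda>x. prod x y)" for y
      using linear_prod[of y] by (simp add: prod_commute[of _ y])
    show "u \<noteq> 0"
    proof
      assume "u = 0"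
      then have "x = 0" for x :: 'v
        using prod_unit[of x] prod_commute[of 0 x] linear_selfD(3)[OF linear_prod[of x]] by simp
      then show False using UNIV_nonzero by auto
    qed
    show "J = {0} \<or> J = UNIV" if J: "subspace J" "\<And>a x. x \<in> J \<Longrightarrow> prod a x \<in> J"
      "\<And>x. x \<in> J \<Longrightarrow> bracket u x \<in> J" for J
    proof (rule ideal_cases, rule idealI)
      show "subspace J" by fact
      show "mult x y \<in> J" if "y \<in> J" for x y
      proof -
        have "prod y u = y" using prod_unit[of y] prod_commute[of u y] by simp
        then have "mult x y = mult x (prod y u)" by simp
        \<comment> \<open>The old multiplication commutes with the new one, so it is multiplication
          by \<open>mult x u\<close>, and ideals of the new product are ideals of the old.\<close>
        also have "\<dots> = prod y (mult x u)"
          by (simp add: prod_def inv_commute[OF mult_derived.mult, symmetric]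
              derived_commute[OF B(2) mult_derived.mult])
        finally show ?thesis using J(2)[OF that, of "mult x u"] prod_commute[of y] by simp
      qed
      show "bracket x y \<in> J" if "y \<in> J" for x y
      proof -
        have "prod y (bracket u x) \<in> J"
          using J(2)[OF that, of "bracket u x"] prod_commute[of y] by simp
        then show ?thesis
          unfolding bracket_eq[of x y] using J that by (intro subspace_diff) auto
      qed
    qed
    show "prod x y = prod y x" for x y by (rule prod_commute)
  qed (simp_all add: vector_space_axioms fin_dim_alg_closed_axioms prod_assoc linear_prod
      prod_unit D_prod lie_algebra.axioms(1)[OF lie_algebra_axioms, THEN bilinear_operation.linear_right])
  then show ?thesis using that bracket_eq by blast
qed

lemma lie_isomorphic_zassenhaus:
  assumes "CHAR('f) > 0"
  shows "\<exists>n\<ge>1. lie_isomorphic scale bracket fun_scale (dp_carrier n) (zassenhaus_bracket n)"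
proof -
  obtain prod u where A: "simple_differential_algebra scale prod Basis u (bracket u)"
    and bracket_eq: "\<And>y z. bracket y z = prod y (bracket u z) - prod z (bracket u y)"
    using exists_unital_product by blast
  interpret A: simple_differential_algebra scale prod Basis u "bracket u" by (rule A)
  have "\<exists>x. bracket u x \<noteq> 0"
  proof (rule ccontr)
    assume "\<not> ?thesis"
    then have "bracket x y = 0" for x y
      using bracket_eq[of x y] by (simp add: A.op_zero_right)
    then show False using is_nontrivial by (simp add: trivial_def)
  qed
  then show ?thesis using A.lie_isomorphic_zassenhaus[OF assms _ bracket_eq] by blast
qed

end

theorem proposition3p1:
  fixes scale :: "'f::alg_closed_field \<Rightarrow> 'v::ab_group_add \<Rightarrow> 'v"
    and mult bracket :: "'v \<Rightarrow> 'v \<Rightarrow> 'v"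
  assumes "CHAR('f) > 3"
    and "transposed_poisson_algebra scale mult bracket"
    and "\<exists>B. finite_dimensional_vector_space scale B"
    and "transposed_poisson_algebra.simple scale mult bracket"
    and "\<not> transposed_poisson_algebra.trivial mult bracket"
  shows "\<exists>n\<ge>1. lie_isomorphic scale bracket
           fun_scale (dp_carrier n) (zassenhaus_bracket n)"
proof -
  obtain B where "finite_dimensional_vector_space scale B"
    using assms(3) by blast
  then have "simple_transposed_poisson_algebra scale mult bracket B"
    using assms by (simp add: simple_transposed_poisson_algebra_def
        simple_transposed_poisson_algebra_axioms_def fin_dim_alg_closed_def)
  then show ?thesis
    using assms(1) by (intro simple_transposed_poisson_algebra.lie_isomorphic_zassenhaus) auto
qed

end
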